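(* Let $p\equiv5\pmod{12}$ be prime with $p=m^2+n^2$ for integers $m,n$, and let $b$ be a positive integer. Let $\mu$ be an integer with $3m\mu\equiv1\pmod p$ and $s=(3m\mu-1)/p$. For integers $k$ let \[ \alpha_k=3bp+3kmp-\tfrac{(m+n)p}{2}+\tfrac{3p^2}{2},\quad \beta_k=3knp+\tfrac{(m-n)p}{2}+\tfrac{3p^2}{2},\quad \gamma_k=3bkm+\tfrac{k(3k-1)p}{2}. \] (1) If $m\equiv-n\pmod3$, then with $\chi_k=\gamma_k+p(1-ns)\big(kn+\tfrac{p+m-n(1+ps)}{6}\big)$, \[ Q(q^{bm},q^p)Q(q^{bn},q^p)=\sum_{k=0}^{p-1}q^{\chi_k}\,W\big(-q^{\alpha_k/3},-q^{(\beta_k-nsp^2)/3};q^{p^2}\big). \] (2) If $m\equiv n\pmod3$, then with $\chi^*_k=\gamma_k+p(1-ms)\big(b+km+\tfrac{p-m(1+ps)-n}{6}\big)$, \[ Q(q^{bm},q^p)Q(q^{bn},q^p)=\sum_{k=0}^{p-1}q^{\chi^*_k}\,W\big(-q^{\beta_k/3},-q^{(\alpha_k-msp^2)/3};q^{p^2}\big). \]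
   Context: For complex $z\neq0$ and $0<|q|<1$: $(z;q)_\infty=\prod_{j\ge0}(1-zq^j)$, $(a_1,\dots,a_j;q)_\infty=\prod_i(a_i;q)_\infty$, $\langle z;q\rangle_\infty=(z,q/z,q;q)_\infty$, $\langle z_1,\dots,z_k;q\rangle_\infty=\prod_i\langle z_i;q\rangle_\infty$, the quintuple product is $Q(z,q)=(z,q/z,q;q)_\infty(qz^2,q/z^2;q^2)_\infty$, and for nonzero $a,b$, $W(a,b;q)=\langle a,b,ab,a/b;q\rangle_\infty\,(q;q)_\infty^{-2}$. The exponents $\alpha_k/3$, $(\beta_k-nsp^2)/3$, $\beta_k/3$, $(\alpha_k-msp^2)/3$ appearing in the respective cases are integers. *)

theory Defs
  imports "HOL-Analysis.Analysis" "HOL-Number_Theory.Number_Theory"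
begin

definition qpoch :: "complex \<Rightarrow> complex \<Rightarrow> complex" where
  "qpoch z q = (\<Prod>j. 1 - z * q ^ j)"

lemma qpoch_has_prod:
  fixes z q :: complex
  assumes "norm q < 1"
  shows "(\<lambda>j. 1 - z * q ^ j) has_prod qpoch z q"
proof -
  have "summable (\<lambda>j. norm z * norm q ^ j)"
    using assms by (intro summable_mult summable_geometric) simp
  then have "summable (\<lambda>j. norm ((1 - z * q ^ j) - 1))"
    by (simp add: norm_mult norm_power)
  then have "abs_convergent_prod (\<lambda>j. 1 - z * q ^ j)"
    by (rule summable_imp_abs_convergent_prod)
  then have "convergent_prod (\<lambda>j. 1 - z * q ^ j)"
    by (rule abs_convergent_prod_imp_convergent_prod)
  then show ?thesis
    unfolding qpoch_def by (rule convergent_prod_has_prod)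
qed

definition qpochs :: "complex list \<Rightarrow> complex \<Rightarrow> complex" where
  "qpochs as q = (\<Prod>a\<leftarrow>as. qpoch a q)"

definition theta :: "complex \<Rightarrow> complex \<Rightarrow> complex" where
  "theta z q = qpochs [z, q / z, q] q"

definition thetas :: "complex list \<Rightarrow> complex \<Rightarrow> complex" where
  "thetas zs q = (\<Prod>z\<leftarrow>zs. theta z q)"

definition quintuple :: "complex \<Rightarrow> complex \<Rightarrow> complex" where
  "quintuple z q = qpochs [z, q / z, q] q * qpochs [q * z\<^sup>2, q / z\<^sup>2] (q\<^sup>2)"

definition W :: "complex \<Rightarrow> complex \<Rightarrow> complex \<Rightarrow> complex" where
  "W a b q = thetas [a, b, a * b, a / b] q * qpoch q q powi (-2)"

text \<open>
  The exponents contain fractions, so they are real-valued here; the lemmas below show that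
  every exponent to which the statement applies the floor function is in fact an integer.
\<close>

definition alpha :: "int \<Rightarrow> int \<Rightarrow> int \<Rightarrow> int \<Rightarrow> int \<Rightarrow> real" where
  "alpha p m n b k = 3*b*p + 3*k*m*p - (m + n)*p / 2 + 3*p\<^sup>2 / 2"

definition beta :: "int \<Rightarrow> int \<Rightarrow> int \<Rightarrow> int \<Rightarrow> real" where
  "beta p m n k = 3*k*n*p + (m - n)*p / 2 + 3*p\<^sup>2 / 2"

definition gamma :: "int \<Rightarrow> int \<Rightarrow> int \<Rightarrow> int \<Rightarrow> real" where
  "gamma p m b k = 3*b*k*m + k*(3*k - 1)*p / 2"

definition chi :: "int \<Rightarrow> int \<Rightarrow> int \<Rightarrow> int \<Rightarrow> int \<Rightarrow> int \<Rightarrow> real" where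
  "chi p m n b s k = gamma p m b k + p*(1 - n * s)*(k*n + (p + m - n*(1 + p * s)) / 6)"

definition chi_star :: "int \<Rightarrow> int \<Rightarrow> int \<Rightarrow> int \<Rightarrow> int \<Rightarrow> int \<Rightarrow> real" where
  "chi_star p m n b s k = gamma p m b k + p*(1 - m * s)*(b + k*m + (p - m*(1 + p * s) - n) / 6)"

context
  fixes p m n s \<mu> :: int
  assumes p: "[p = 5] (mod 12)" and pmn: "p = m\<^sup>2 + n\<^sup>2" and s: "p * s = 3*m*\<mu> - 1"
begin

lemma p_mod: "p mod 2 = 1" "p mod 3 = 2"
  using p unfolding cong_def by presburger+

lemma ps_mod: "(p * s) mod 3 = 2"
proof -
  have "p * s = 3 * (m * \<mu>) - 1" using s by simp
  then show ?thesis by presburger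
qed

lemma s_mod: "s mod 3 = 1"
proof -
  have "(p * s) mod 3 = (2 * s) mod 3"
    using p_mod(2) by (metis mod_mult_left_eq)
  with ps_mod show ?thesis by presburger
qed

lemma mn_odd: "odd (m + n)"
proof -
  have "odd (m\<^sup>2 + n\<^sup>2)" using p_mod(1) unfolding pmn by (simp only: odd_iff_mod_2_eq_one)
  then show ?thesis by simp
qed

lemma m_mod: "m mod 3 \<noteq> 0" if "3 dvd m + n \<or> 3 dvd m - n"
proof
  assume "m mod 3 = 0"
  with that have "3 dvd m" "3 dvd n" by presburger+
  then have "3 dvd p" unfolding pmn by (simp add: power2_eq_square)
  then show False using p_mod(2) by presburger
qed

lemma six_dvd_iff: "6 dvd x \<longleftrightarrow> 2 dvd x \<and> 3 dvd x" for x :: int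
  by presburger

lemma of_int_div_Ints: "real_of_int x / real_of_int d \<in> \<int>" if "d dvd x"
  using that by (metis Ints_of_int real_of_int_div)

lemma gamma_Ints: "gamma p m b k \<in> \<int>"
proof -
  have "2 dvd k * (3 * k - 1) * p" by auto
  from of_int_div_Ints[OF this] have "k * (3 * k - 1) * p / 2 \<in> \<int>" by simp
  moreover have "real_of_int (3*b*k*m) \<in> \<int>" by (rule Ints_of_int)
  ultimately show ?thesis unfolding gamma_def by (intro Ints_add) simp_all
qed

lemma alpha_Ints: "alpha p m n b k / 3 \<in> \<int>" if "[m = -n] (mod 3)"
proof -
  have "3 dvd m + n" using that by (simp add: cong_iff_dvd_diff)
  then have "6 dvd 3 * p - (m + n)"
    using mn_odd p_mod unfolding six_dvd_iff by presburger
  from of_int_div_Ints[OF dvd_mult[OF this, of p]]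
  have "p * (3 * p - (m + n)) / 6 \<in> \<int>" by simp
  moreover have "alpha p m n b k / 3 = of_int (b*p + k*m*p) + p * (3 * p - (m + n)) / 6"
    unfolding alpha_def by (simp add: field_simps power2_eq_square)
  ultimately show ?thesis by (metis Ints_add Ints_of_int)
qed

lemma beta_shift_Ints: "(beta p m n k - n * s*p\<^sup>2) / 3 \<in> \<int>" if "[m = -n] (mod 3)"
proof -
  have mn: "3 dvd m + n" using that by (simp add: cong_iff_dvd_diff)
  have eq: "3 * p + m - n - 2 * n * s * p = 3 * p + (m + n) - 2 * n * (p * s + 1)"
    by (simp add: algebra_simps)
  have "3 dvd p * s + 1" unfolding s by simp
  then have "3 dvd 3 * p + (m + n) - 2 * n * (p * s + 1)"
    using mn by (meson dvd_add dvd_diff dvd_mult dvd_triv_left)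
  moreover have "2 dvd 3 * p + (m + n) - 2 * n * (p * s + 1)"
    using mn_odd p_mod(1) by (auto simp: even_iff_mod_2_eq_zero[symmetric] odd_iff_mod_2_eq_one[symmetric])
  ultimately have "6 dvd 3 * p + m - n - 2 * n * s * p"
    unfolding six_dvd_iff eq by simp
  from of_int_div_Ints[OF dvd_mult[OF this, of p]]
  have "p * (3 * p + m - n - 2 * n * s * p) / 6 \<in> \<int>" by simp
  moreover have "(beta p m n k - n * s*p\<^sup>2) / 3
      = of_int (k*n*p) + p * (3 * p + m - n - 2 * n * s * p) / 6"
    unfolding beta_def by (simp add: field_simps power2_eq_square)
  ultimately show ?thesis by (metis Ints_add Ints_of_int)
qed

lemma beta_Ints: "beta p m n k / 3 \<in> \<int>" if "[m = n] (mod 3)"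
proof -
  have "3 dvd m - n" using that by (simp add: cong_iff_dvd_diff)
  then have "6 dvd 3 * p + (m - n)"
    using mn_odd p_mod unfolding six_dvd_iff by presburger
  from of_int_div_Ints[OF dvd_mult[OF this, of p]]
  have "p * (3 * p + (m - n)) / 6 \<in> \<int>" by simp
  moreover have "beta p m n k / 3 = of_int (k*n*p) + p * (3 * p + (m - n)) / 6"
    unfolding beta_def by (simp add: field_simps power2_eq_square)
  ultimately show ?thesis by (metis Ints_add Ints_of_int)
qed

lemma alpha_shift_Ints: "(alpha p m n b k - m * s*p\<^sup>2) / 3 \<in> \<int>" if "[m = n] (mod 3)"
proof -
  have mn: "3 dvd m - n" using that by (simp add: cong_iff_dvd_diff)
  have eq: "3 * p - (m + n) - 2 * m * s * p = 3 * p + (m - n) - 2 * m * (p * s + 1)"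
    by (simp add: algebra_simps)
  have "3 dvd p * s + 1" unfolding s by simp
  then have "3 dvd 3 * p + (m - n) - 2 * m * (p * s + 1)"
    using mn by (meson dvd_add dvd_diff dvd_mult dvd_triv_left)
  moreover have "2 dvd 3 * p + (m - n) - 2 * m * (p * s + 1)"
    using mn_odd p_mod(1) by (auto simp: even_iff_mod_2_eq_zero[symmetric] odd_iff_mod_2_eq_one[symmetric])
  ultimately have "6 dvd 3 * p - (m + n) - 2 * m * s * p"
    unfolding six_dvd_iff eq by simp
  from of_int_div_Ints[OF dvd_mult[OF this, of p]]
  have "p * (3 * p - (m + n) - 2 * m * s * p) / 6 \<in> \<int>" by simp
  moreover have "(alpha p m n b k - m * s*p\<^sup>2) / 3
      = of_int (b*p + k*m*p) + p * (3 * p - (m + n) - 2 * m * s * p) / 6"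
    unfolding alpha_def by (simp add: field_simps power2_eq_square)
  ultimately show ?thesis by (metis Ints_add Ints_of_int)
qed

lemma chi_Ints: "chi p m n b s k \<in> \<int>" if "[m = -n] (mod 3)"
proof -
  have mn: "3 dvd m + n" using that by (simp add: cong_iff_dvd_diff)
  have 1: "3 dvd n * (1 + p * s)" using ps_mod by (intro dvd_mult) presburger
  have 2: "(n * s) mod 3 = n mod 3"
    using s_mod by (metis mod_mult_right_eq mult.right_neutral)
  have "3 dvd 1 - n * s \<or> 3 dvd p + m - n * (1 + p * s)"
    using 1 2 mn m_mod p_mod(2) by presburger
  then have "3 dvd (1 - n * s) * (p + m - n * (1 + p * s))" by auto
  moreover have "2 dvd (1 - n * s) * (p + m - n * (1 + p * s))"
    using mn_odd p_mod(1) by (auto simp: even_iff_mod_2_eq_zero[symmetric] odd_iff_mod_2_eq_one[symmetric])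
  ultimately have "6 dvd (1 - n * s) * (p + m - n * (1 + p * s))"
    unfolding six_dvd_iff by simp
  from of_int_div_Ints[OF dvd_mult[OF this, of p]]
  have "p * ((1 - n * s) * (p + m - n * (1 + p * s))) / 6 \<in> \<int>" by simp
  moreover have "chi p m n b s k = gamma p m b k + of_int (p*(1 - n * s)*(k*n))
      + p * ((1 - n * s) * (p + m - n * (1 + p * s))) / 6"
    unfolding chi_def by (simp add: field_simps)
  ultimately show ?thesis using gamma_Ints by (metis Ints_add Ints_of_int)
qed

lemma chi_star_Ints: "chi_star p m n b s k \<in> \<int>" if "[m = n] (mod 3)"
proof -
  have mn: "3 dvd m - n" using that by (simp add: cong_iff_dvd_diff)
  have 1: "3 dvd m * (1 + p * s)" using ps_mod by (intro dvd_mult) presburger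
  have 2: "(m * s) mod 3 = m mod 3"
    using s_mod by (metis mod_mult_right_eq mult.right_neutral)
  have "3 dvd 1 - m * s \<or> 3 dvd p - m * (1 + p * s) - n"
    using 1 2 mn m_mod p_mod(2) by presburger
  then have "3 dvd (1 - m * s) * (p - m * (1 + p * s) - n)" by auto
  moreover have "2 dvd (1 - m * s) * (p - m * (1 + p * s) - n)"
    using mn_odd p_mod(1) by (auto simp: even_iff_mod_2_eq_zero[symmetric] odd_iff_mod_2_eq_one[symmetric])
  ultimately have "6 dvd (1 - m * s) * (p - m * (1 + p * s) - n)"
    unfolding six_dvd_iff by simp
  from of_int_div_Ints[OF dvd_mult[OF this, of p]]
  have "p * ((1 - m * s) * (p - m * (1 + p * s) - n)) / 6 \<in> \<int>" by simp
  moreover have "chi_star p m n b s k = gamma p m b k + of_int (p*(1 - m * s)*(b + k*m))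
      + p * ((1 - m * s) * (p - m * (1 + p * s) - n)) / 6"
    unfolding chi_star_def by (simp add: field_simps)
  ultimately show ?thesis using gamma_Ints by (metis Ints_add Ints_of_int)
qed

end

end

theory Submission
  imports Defs
begin

text \<open>
  By the quintuple product identity, the left-hand side is a double series over pairs \<open>(x, y)\<close> of
  integers congruent to \<open>0\<close> or \<open>1\<close> modulo \<open>3\<close>, with a quadratic form proportional to \<open>x\<^sup>2 + y\<^sup>2\<close>.
  Since \<open>m\<^sup>2 + n\<^sup>2 = p\<close>, the map \<open>(i, j) \<mapsto> (m i + n j, n i - m j)\<close> embeds \<open>\<int>\<^sup>2\<close> as a sublattice of
  index \<open>p\<close> with coset representatives \<open>(k, 0)\<close>, and scales the form by \<open>p\<close>. On every coset the
  series becomes a product of two theta functions of base \<open>q powi (3 * p\<^sup>2)\<close>, and the four residue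
  classes of \<open>(x, y)\<close>, suitably shifted, give the four products in Winquist's identity.

  Winquist's identity itself is obtained by expanding \<open>theta a * theta (a * b) * theta (a / b)\<close> as a
  Laurent series in \<open>a\<close>: its coefficients are quasi-periodic with step three and antisymmetric, which
  leaves two unknown functions of \<open>b\<close>. Setting \<open>a\<close> to a primitive cube root of unity yields one of
  them, and the antisymmetry of \<open>W\<close> in its two arguments yields the other.
\<close>

section \<open>The Jacobi triple product\<close>

definition tri :: "int \<Rightarrow> int" where
  "tri n = n * (n - 1) div 2"

lemma two_tri: "2 * tri n = n * (n - 1)"
  unfolding tri_def by (rule dvd_mult_div_cancel) simp

lemma tri_eqI: "2 * x = n * (n - 1) \<Longrightarrow> tri n = x"
  using two_tri[of n] by simp

lemma tri_add: "tri (m + n) = tri m + tri n + m * n"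
  using two_tri[of m] two_tri[of n] by (intro tri_eqI) (simp add: algebra_simps)

lemma tri_reflect: "tri (1 - n) = tri n"
  using two_tri[of n] by (intro tri_eqI) (simp add: algebra_simps)

lemma tri_0 [simp]: "tri 0 = 0" and tri_1 [simp]: "tri 1 = 0"
  by (simp_all add: tri_def)

lemma tri_add_1: "tri (n + 1) = tri n + n"
  by (simp add: tri_add)

definition jacobi_term :: "complex \<Rightarrow> complex \<Rightarrow> int \<Rightarrow> complex" where
  "jacobi_term z q n = (- 1) powi n * q powi tri n * z powi n"

text \<open>Ratio test: consecutive terms have quotient \<open>r ^ k * x\<close>, which tends to 0
  because \<open>r < 1\<close>.\<close>

lemma summable_gaussian_nat:
  fixes r x :: real
  assumes "0 < r" "r < 1" "0 < x"
  shows "summable (\<lambda>k::nat. r powi tri (int k) * x powi int k)"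
proof -
  define f where "f = (\<lambda>k::nat. r powi tri (int k) * x powi int k)"
  have f_pos: "f k > 0" for k
    using assms by (simp add: f_def)
  have f_Suc: "f (Suc k) = f k * (r ^ k * x)" for k
    using assms by (simp add: f_def tri_add_1 add.commute[of 1] power_int_add)
  have "(\<lambda>k. r ^ k * x) \<longlonglongrightarrow> 0 * x"
    by (intro tendsto_mult tendsto_const LIMSEQ_power_zero) (use assms in auto)
  then have "eventually (\<lambda>k. r ^ k * x < 1/2) sequentially"
    by (intro order_tendstoD(2)) auto
  then obtain N where N: "\<And>k. k \<ge> N \<Longrightarrow> r ^ k * x < 1/2"
    by (auto simp: eventually_sequentially)
  have "summable f"
  proof (rule summable_ratio_test[of "1/2" N])
    fix k assume "N \<le> k"
    then have "f k * (r ^ k * x) \<le> f k * (1/2)"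
      using N[of k] f_pos[of k] by (intro mult_left_mono) auto
    then show "norm (f (Suc k)) \<le> 1/2 * norm (f k)"
      using f_pos[of k] f_pos[of "Suc k"] by (simp add: f_Suc)
  qed simp
  then show ?thesis by (simp add: f_def)
qed

text \<open>The reflection of \<open>n\<close> to \<open>1 - n\<close> fixes \<open>tri\<close> and
  replaces \<open>x\<close> by \<open>inverse x\<close> up to a factor \<open>x\<close>, so the
  negative half reduces to a tail of the nonnegative one.\<close>

lemma summable_gaussian_int:
  fixes r x :: real
  assumes "0 < r" "r < 1" "0 < x"
  shows "(\<lambda>n. r powi tri n * x powi n) summable_on UNIV"
proof -
  define f where "f = (\<lambda>x (n::int). r powi tri n * x powi n)"
  have pos: "f x summable_on {0..}" if "0 < x" for x
  proof -
    have "(\<lambda>k. f x (int k)) summable_on UNIV"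
      unfolding f_def
      by (subst summable_on_UNIV_nonneg_real_iff)
         (use that assms summable_gaussian_nat in auto)
    then show ?thesis
      by (subst summable_on_reindex_bij_witness[of "{0..}" int nat UNIV "\<lambda>k. f x (int k)"]) auto
  qed
  have refl: "f x (1 - n) = x * f (inverse x) n" if "x > 0" for x n
    using that by (simp add: f_def tri_reflect power_int_diff power_int_inverse field_simps)
  have "(\<lambda>n. x * f (inverse x) n) summable_on {2..}"
    by (rule summable_on_cmult_right, rule summable_on_subset[OF pos]) (use assms in auto)
  then have neg: "f x summable_on {..<0}"
    by (subst summable_on_reindex_bij_witness
          [of "{..<0}" "\<lambda>n. 1 - n" "\<lambda>n. 1 - n" "{2..}" "\<lambda>n. x * f (inverse x) n"])
       (use assms refl[of x "1 - n" for n] in auto)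
  have "f x summable_on ({0..} \<union> {..<0})"
    by (intro summable_on_Un_disjoint pos neg assms) auto
  also have "{0..} \<union> {..<0} = (UNIV :: int set)" by auto
  finally show ?thesis by (simp add: f_def)
qed

lemma abs_summable_jacobi_term:
  assumes "0 < norm q" "norm q < 1" "z \<noteq> 0"
  shows "(\<lambda>n. norm (jacobi_term z q n)) summable_on UNIV"
  using summable_gaussian_int[of "norm q" "norm z"] assms
  by (simp add: jacobi_term_def norm_mult norm_power_int)

section \<open>Gaussian binomial coefficients and the finite triple product\<close>

fun qbinomial :: "complex \<Rightarrow> nat \<Rightarrow> nat \<Rightarrow> complex" where
  "qbinomial q n 0 = 1"
| "qbinomial q 0 (Suc k) = 0"
| "qbinomial q (Suc n) (Suc k) = qbinomial q n (Suc k) + q ^ (n - k) * qbinomial q n k"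

text \<open>The finite product \<open>(q;q)_n\<close>, without the normalising denominator
  \<open>(1 - q)^n\<close> of the usual q-factorial, so that it converges to
  \<open>qpoch q q\<close> for \<open>norm q < 1\<close>.\<close>

definition qfact :: "complex \<Rightarrow> nat \<Rightarrow> complex" where
  "qfact q n = (\<Prod>i<n. 1 - q ^ Suc i)"

lemma qfact_0 [simp]: "qfact q 0 = 1" and qfact_Suc: "qfact q (Suc n) = qfact q n * (1 - q ^ Suc n)"
  by (simp_all add: qfact_def)

lemma qbinomial_eq_0: "n < k \<Longrightarrow> qbinomial q n k = 0"
  by (induction q n k rule: qbinomial.induct) auto

text \<open>The closed form of the Gaussian binomial with denominators cleared. With
  \<open>n = k + d + 1\<close> the recurrence reduces to
  \<open>1 - q^(n+1) = (1 - q^(d+1)) + q^(d+1) * (1 - q^(k+1))\<close>.\<close>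

lemma qbinomial_qfact: "k \<le> n \<Longrightarrow> qbinomial q n k * qfact q k * qfact q (n - k) = qfact q n"
proof (induction q n k rule: qbinomial.induct)
  case (3 q n k)
  have IH2: "qbinomial q n k * qfact q k * qfact q (n - k) = qfact q n"
    using 3 by simp
  show ?case
  proof (cases "k < n")
    case True
    then obtain d where d: "n = Suc (k + d)"
      using less_iff_Suc_add by auto
    have IH1: "qbinomial q n (Suc k) * qfact q (Suc k) * qfact q d = qfact q n"
      using 3(1) d by simp
    have "qbinomial q (Suc n) (Suc k) * qfact q (Suc k) * qfact q (Suc n - Suc k) =
        (qbinomial q n (Suc k) * qfact q (Suc k) * qfact q d) * (1 - q ^ Suc d) +
        q ^ Suc d * (1 - q ^ Suc k) * (qbinomial q n k * qfact q k * qfact q (n - k))"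
      by (simp add: d qfact_Suc Suc_diff_le algebra_simps)
    also have "\<dots> = qfact q (Suc n)"
      unfolding IH1 IH2 by (simp add: qfact_Suc d algebra_simps power_add)
    finally show ?thesis .
  next
    case False
    with 3 have "k = n" by simp
    have "qbinomial q (Suc n) (Suc n) * qfact q (Suc n) * qfact q 0 =
        (qbinomial q n n * qfact q n * qfact q (n - n)) * (1 - q ^ Suc n)"
      by (simp add: qbinomial_eq_0 qfact_Suc)
    then show ?thesis
      unfolding IH2[unfolded \<open>k = n\<close>] \<open>k = n\<close> by (simp add: qfact_Suc)
  qed
qed auto

text \<open>Induction on \<open>n\<close>: the recurrence splits the new sum into the old one and a
  shifted one, and the latter is the old sum times \<open>- z * q ^ n\<close>, the contribution of
  the new factor.\<close>

lemma qbinomial_theorem: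
  fixes q z :: complex
  assumes "q \<noteq> 0"
  shows "(\<Prod>j<n. 1 - z * q ^ j) =
    (\<Sum>k\<le>n. qbinomial q n k * ((- 1) ^ k * q powi tri (int k) * z ^ k))"
proof (induction n)
  case (Suc n)
  define t where "t = (\<lambda>k. (- 1) ^ k * q powi tri (int k) * z ^ k)"
  have t_Suc: "t (Suc k) = - (t k * q ^ k * z)" for k
    using assms by (simp add: t_def tri_add_1 add.commute[of 1] power_int_add)
  have "(\<Sum>k\<le>Suc n. qbinomial q (Suc n) k * t k)
      = t 0 + (\<Sum>k\<le>n. qbinomial q (Suc n) (Suc k) * t (Suc k))"
    by (subst sum.atMost_Suc_shift) simp
  also have "\<dots> = t 0 + (\<Sum>k\<le>n. qbinomial q n (Suc k) * t (Suc k))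
      + (\<Sum>k\<le>n. q ^ (n - k) * qbinomial q n k * t (Suc k))"
    by (simp add: algebra_simps sum.distrib)
  also have "t 0 + (\<Sum>k\<le>n. qbinomial q n (Suc k) * t (Suc k)) = (\<Sum>k\<le>Suc n. qbinomial q n k * t k)"
    by (subst sum.atMost_Suc_shift) simp
  also have "\<dots> = (\<Sum>k\<le>n. qbinomial q n k * t k)"
    by (simp add: qbinomial_eq_0)
  also have "(\<Sum>k\<le>n. q ^ (n - k) * qbinomial q n k * t (Suc k)) =
      (\<Sum>k\<le>n. - (z * q ^ n) * (qbinomial q n k * t k))"
  proof (rule sum.cong)
    fix k assume "k \<in> {..n}"
    then have "q ^ n = q ^ (n - k) * q ^ k" by (simp flip: power_add)
    then show "q ^ (n - k) * qbinomial q n k * t (Suc k) = - (z * q ^ n) * (qbinomial q n k * t k)"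
      by (simp add: t_Suc)
  qed simp
  also have "(\<Sum>k\<le>n. qbinomial q n k * t k) + \<dots> = (\<Sum>k\<le>n. qbinomial q n k * t k) * (1 - z * q ^ n)"
    by (simp only: sum_distrib_left[symmetric]) (simp add: algebra_simps)
  finally show ?case
    using Suc.IH by (simp add: t_def)
qed simp

text \<open>The q-binomial theorem for \<open>2 * n\<close> factors starting at
  \<open>z * q powi (- N)\<close>: the upper \<open>n\<close> factors give the product in
  \<open>z\<close>, the lower \<open>n\<close>, read backwards, the product in \<open>q / z\<close>.
  The index is recentred by \<open>k = N + i\<close>.\<close>

lemma finite_jacobi_triple_product:
  fixes q z :: complex
  assumes q: "q \<noteq> 0" and z: "z \<noteq> 0"
  shows "(\<Prod>j<n. 1 - z * q ^ j) * (\<Prod>j<n. 1 - q / z * q ^ j) =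
    (\<Sum>i\<in>{- int n..int n}. qbinomial q (2 * n) (nat (int n + i)) * jacobi_term z q i)"
proof -
  define N where "N = int n"
  \<comment> \<open>\<open>C\<close> collects the monomials \<open>- z * q powi (- (j + 1))\<close>
    pulled out of the lower factors; the exponents from 1 to \<open>n\<close> add up to
    \<open>tri (N + 1)\<close>.\<close>
  define C where "C = (- 1) ^ n * z ^ n * q powi (- tri (N + 1))"
  have C: "C \<noteq> 0" using q z by (simp add: C_def)
  have neg: "(\<Prod>j<n. 1 - z * q powi (- int (Suc j))) = C * (\<Prod>j<n. 1 - q / z * q ^ j)"
    unfolding C_def N_def
  proof (induction n)
    case (Suc n)
    have "1 - z * q powi (- int (Suc n)) = - z * q powi (- int (Suc n)) * (1 - q / z * q ^ n)"
      using q z by (simp add: power_int_minus field_simps del: of_nat_Suc)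
    moreover have "tri (int (Suc n) + 1) = tri (int n + 1) + int (Suc n)"
      using tri_add_1[of "int n + 1"] by (simp add: add.commute)
    then have "q powi (- tri (int (Suc n) + 1)) = q powi (- tri (int n + 1)) * q powi (- int (Suc n))"
      using q power_int_add[of q "- tri (int n + 1)" "- int (Suc n)"] by (simp del: of_nat_Suc)
    ultimately show ?case
      by (simp add: Suc.IH del: of_nat_Suc)
  qed simp
  have "(\<Prod>j<2 * n. 1 - (z * q powi (- N)) * q ^ j)
      = (\<Prod>j<n. 1 - (z * q powi (- N)) * q ^ j) * (\<Prod>j<n. 1 - (z * q powi (- N)) * q ^ (n + j))"
    using prod.atLeastLessThan_concat[of 0 n "n + n" "\<lambda>j. 1 - (z * q powi (- N)) * q ^ j"]
      prod.shift_bounds_nat_ivl[of "\<lambda>j. 1 - (z * q powi (- N)) * q ^ j" 0 n n]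
    by (simp add: mult_2 lessThan_atLeast0 add.commute)
  also have "(\<Prod>j<n. 1 - (z * q powi (- N)) * q ^ (n + j)) = (\<Prod>j<n. 1 - z * q ^ j)"
    using q by (intro prod.cong) (simp_all add: N_def power_add power_int_minus)
  also have "(\<Prod>j<n. 1 - (z * q powi (- N)) * q ^ j) = (\<Prod>j<n. 1 - z * q powi (- int (Suc j)))"
  proof (subst prod.nat_diff_reindex[symmetric], rule prod.cong)
    fix j assume "j \<in> {..<n}"
    then have "q powi (- int (Suc j)) = q powi (- N + int (n - Suc j))"
      by (simp add: N_def of_nat_diff)
    also have "\<dots> = q powi (- N) * q ^ (n - Suc j)"
      using q by (subst power_int_add) auto
    finally show "1 - z * q powi (- N) * q ^ (n - Suc j) = 1 - z * q powi (- int (Suc j))"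
      by simp
  qed simp
  finally have lhs: "C * ((\<Prod>j<n. 1 - z * q ^ j) * (\<Prod>j<n. 1 - q / z * q ^ j)) =
      (\<Prod>j<2 * n. 1 - (z * q powi (- N)) * q ^ j)"
    unfolding neg by (simp only: mult_ac)
  also have "\<dots> = (\<Sum>k\<le>2 * n. qbinomial q (2 * n) k *
      ((- 1) ^ k * q powi tri (int k) * (z * q powi (- N)) ^ k))"
    by (rule qbinomial_theorem[OF q])
  also have "\<dots> = (\<Sum>i\<in>{- N..N}. C * (qbinomial q (2 * n) (nat (N + i)) * jacobi_term z q i))"
  proof (rule sum.reindex_bij_witness[of _ "\<lambda>i. nat (N + i)" "\<lambda>k. int k - N"])
    fix k assume k: "k \<in> {..2 * n}"
    define i where "i = int k - N"
    have ki: "int k = N + i" by (simp add: i_def)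
    \<comment> \<open>The shift by \<open>- N\<close> cancels the mixed term \<open>N * i\<close> of
      \<open>tri (N + i)\<close>; the constant left over is absorbed in \<open>C\<close>.\<close>
    have "tri (int k) - N * int k = tri i - tri (N + 1)"
      unfolding ki using two_tri[of N] two_tri[of "N+1"] by (simp add: tri_add algebra_simps)
    then have "q powi tri (int k) * (q powi (- N)) ^ k = q powi tri i * q powi (- tri (N + 1))"
      using q by (simp add: power_int_power' flip: power_int_add)
    moreover have "(- 1 :: complex) ^ k = (- 1) ^ n * (- 1) powi i"
      using power_int_add[of "-1 :: complex" N i] by (simp flip: ki) (simp add: N_def)
    moreover have "z ^ k = z ^ n * z powi i"
      using power_int_add[of z N i] z by (simp flip: ki) (simp add: N_def)
    moreover have "nat (N + i) = k"
      by (simp add: i_def)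
    ultimately show "C * (qbinomial q (2 * n) (nat (N + (int k - N))) * jacobi_term z q (int k - N)) =
        qbinomial q (2 * n) k * ((- 1) ^ k * q powi tri (int k) * (z * q powi (- N)) ^ k)"
      by (simp add: C_def jacobi_term_def power_mult_distrib flip: i_def)
  qed (auto simp: N_def)
  finally show ?thesis
    using C by (simp flip: sum_distrib_left add: N_def)
qed

section \<open>Passage to the limit in the finite triple product\<close>

lemma qpoch_tendsto: "norm q < 1 \<Longrightarrow> (\<lambda>n. \<Prod>j<n. 1 - z * q ^ j) \<longlonglongrightarrow> qpoch z q"
  by (intro has_prod_imp_tendsto' qpoch_has_prod)

lemma norm_power_Suc_less_1:
  fixes q :: complex
  assumes "norm q < 1"
  shows "norm (q ^ Suc i) < 1"
  using assms by (simp add: norm_power power_less_one_iff del: power_Suc)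

lemma power_Suc_neq_1:
  fixes q :: complex
  assumes "norm q < 1"
  shows "q ^ Suc i \<noteq> 1"
  using norm_power_Suc_less_1[OF assms, of i] by auto

lemma qpoch_nonzero: "norm q < 1 \<Longrightarrow> (\<And>j. 1 - z * q ^ j \<noteq> 0) \<Longrightarrow> qpoch z q \<noteq> 0"
  using has_prod_eq_0_iff[OF qpoch_has_prod[of q z]] by auto

lemma qpoch_q_q_nonzero: "norm q < 1 \<Longrightarrow> qpoch q q \<noteq> 0"
  using qpoch_nonzero[of q q] power_Suc_neq_1[of q] by simp

lemma qfact_tendsto: "norm q < 1 \<Longrightarrow> qfact q \<longlonglongrightarrow> qpoch q q"
  using qpoch_tendsto[of q q] by (simp add: qfact_def [abs_def])

lemma qfact_nonzero: "norm q < 1 \<Longrightarrow> qfact q n \<noteq> 0"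
  using power_Suc_neq_1[of q] by (auto simp: qfact_def)

text \<open>One bound for all \<open>n\<close> and \<open>k\<close> at once, as dominated
  convergence requires: \<open>qfact\<close> and its inverse both converge, hence are
  bounded.\<close>

lemma qbinomial_bounded:
  assumes "norm q < 1"
  obtains B where "\<And>n k. norm (qbinomial q n k) \<le> B"
proof -
  have "Bseq (qfact q)"
    using assms qfact_tendsto convergentI Bseq_eq_bounded convergent_imp_Bseq by blast
  then obtain B1 where B1: "\<And>n. norm (qfact q n) \<le> B1" "B1 > 0"
    by (metis BseqE)
  have "(\<lambda>n. inverse (qfact q n)) \<longlonglongrightarrow> inverse (qpoch q q)"
    by (intro tendsto_inverse qfact_tendsto qpoch_q_q_nonzero assms)
  then have "Bseq (\<lambda>n. inverse (qfact q n))"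
    using convergentI convergent_imp_Bseq by blast
  then obtain B2 where B2: "\<And>n. norm (inverse (qfact q n)) \<le> B2" "B2 > 0"
    by (metis BseqE)
  have "norm (qbinomial q n k) \<le> B1 * (B2 * B2)" for n k
  proof (cases "k \<le> n")
    case True
    have "qbinomial q n k = qfact q n * (inverse (qfact q k) * inverse (qfact q (n - k)))"
      using qbinomial_qfact[OF True, of q] qfact_nonzero[OF assms] by (simp add: field_simps)
    then show ?thesis
      using B1 B2 by (simp only: norm_mult) (intro mult_mono mult_nonneg_nonneg; simp add: less_imp_le)
  qed (use B1 B2 in \<open>simp add: qbinomial_eq_0\<close>)
  then show ?thesis using that by blast
qed

text \<open>In the closed form all three \<open>qfact\<close> factors tend to
  \<open>qpoch q q\<close>, and one of them cancels.\<close>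

lemma qbinomial_central_tendsto:
  assumes "norm q < 1"
  shows "(\<lambda>n. qbinomial q (2 * n) (nat (int n + i))) \<longlonglongrightarrow> inverse (qpoch q q)"
proof -
  have lim: "filterlim (\<lambda>n. nat (int n + j)) sequentially sequentially" for j
    by (rule filterlim_at_top_mono[OF filterlim_minus_const_nat_at_top[of "nat \<bar>j\<bar>"]])
       (auto intro!: always_eventually)
  have *: "filterlim (\<lambda>n. 2 * n) sequentially (sequentially :: nat filter)"
    by (rule filterlim_at_top_mono[OF filterlim_ident]) (auto intro!: always_eventually)
  have "(\<lambda>n. qfact q (2 * n) / (qfact q (nat (int n + i)) * qfact q (nat (int n - i))))
      \<longlonglongrightarrow> qpoch q q / (qpoch q q * qpoch q q)"
    using lim[of i] lim[of "- i"] *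
    by (intro tendsto_divide tendsto_mult filterlim_compose[OF qfact_tendsto[OF assms]])
       (use qpoch_q_q_nonzero[OF assms] in auto)
  moreover have "eventually (\<lambda>n. qfact q (2 * n) / (qfact q (nat (int n + i)) * qfact q (nat (int n - i)))
      = qbinomial q (2 * n) (nat (int n + i))) sequentially"
    using eventually_ge_at_top[of "nat \<bar>i\<bar>"]
  proof eventually_elim
    case (elim n)
    have le: "nat (int n + i) \<le> 2 * n" and "2 * n - nat (int n + i) = nat (int n - i)"
      using elim by linarith+
    then show ?case
      using qbinomial_qfact[OF le, of q] qfact_nonzero[OF assms] by (simp add: field_simps)
  qed
  ultimately show ?thesis
    using qpoch_q_q_nonzero[OF assms] by (simp add: Lim_transform_eventually field_simps)
qed

text \<open>Limit of the finite identity by dominated convergence for the counting measure on the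
  integers; multiplying by \<open>qpoch q q\<close> completes the two products to
  \<open>theta\<close>.\<close>

theorem jacobi_triple_product:
  assumes q: "0 < norm q" "norm q < 1" and z: "z \<noteq> 0"
  shows "(jacobi_term z q has_sum theta z q) UNIV"
proof -
  obtain B where B: "\<And>n k. norm (qbinomial q n k) \<le> B"
    using qbinomial_bounded[OF q(2)] by blast
  define M where "M = count_space (UNIV :: int set)"
  \<comment> \<open>Truncated summand, extended by 0 so that all finite sums become integrals over
    one measure space.\<close>
  define s where "s = (\<lambda>n i. if i \<in> {- int n..int n}
    then qbinomial q (2 * n) (nat (int n + i)) * jacobi_term z q i else 0)"
  have int_jt: "integrable M (jacobi_term z q)"
    using abs_summable_jacobi_term[OF q z] abs_summable_equivalent[of "jacobi_term z q" UNIV]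
    by (simp add: Infinite_Set_Sum.abs_summable_on_def M_def)
  have "(\<lambda>n. integral\<^sup>L M (s n)) \<longlonglongrightarrow> integral\<^sup>L M (\<lambda>i. inverse (qpoch q q) * jacobi_term z q i)"
  proof (rule integral_dominated_convergence[where w = "\<lambda>i. B * norm (jacobi_term z q i)"])
    show "integrable M (\<lambda>i. B * norm (jacobi_term z q i))"
      using int_jt by (intro integrable_mult_right integrable_norm)
    show "AE i in M. (\<lambda>n. s n i) \<longlonglongrightarrow> inverse (qpoch q q) * jacobi_term z q i"
    proof (rule AE_I2)
      fix i
      have "(\<lambda>n. qbinomial q (2 * n) (nat (int n + i)) * jacobi_term z q i)
          \<longlonglongrightarrow> inverse (qpoch q q) * jacobi_term z q i"
        by (intro tendsto_mult tendsto_const qbinomial_central_tendsto q)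
      moreover have "eventually (\<lambda>n. qbinomial q (2 * n) (nat (int n + i)) * jacobi_term z q i = s n i) sequentially"
        using eventually_ge_at_top[of "nat \<bar>i\<bar>"] by eventually_elim (auto simp: s_def)
      ultimately show "(\<lambda>n. s n i) \<longlonglongrightarrow> inverse (qpoch q q) * jacobi_term z q i"
        by (rule Lim_transform_eventually)
    qed
    have "B \<ge> 0" using B[of 0 0] by (meson norm_ge_zero order_trans)
    then show "AE i in M. norm (s n i) \<le> B * norm (jacobi_term z q i)" for n
      using B by (intro AE_I2) (auto simp: s_def norm_mult intro!: mult_right_mono)
  qed (auto simp: M_def)
  moreover have "integral\<^sup>L M (s n) = (\<Prod>j<n. 1 - z * q ^ j) * (\<Prod>j<n. 1 - q / z * q ^ j)" for n
  proof -
    have "integral\<^sup>L M (s n) = (\<Sum>i\<in>{- int n..int n}. s n i)"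
      unfolding M_def
      by (subst lebesgue_integral_count_space_finite_support)
         (auto simp: s_def intro!: sum.mono_neutral_left
               intro: finite_subset[of _ "{- int n..int n}"] split: if_splits)
    then show ?thesis
      using q z by (subst finite_jacobi_triple_product) (auto simp: s_def)
  qed
  moreover have "(\<lambda>n. (\<Prod>j<n. 1 - z * q ^ j) * (\<Prod>j<n. 1 - q / z * q ^ j))
      \<longlonglongrightarrow> qpoch z q * qpoch (q / z) q"
    by (intro tendsto_mult qpoch_tendsto q)
  ultimately have "integral\<^sup>L M (\<lambda>i. inverse (qpoch q q) * jacobi_term z q i) = qpoch z q * qpoch (q / z) q"
    using LIMSEQ_unique by auto
  then have "integral\<^sup>L M (jacobi_term z q) = theta z q"
    using qpoch_q_q_nonzero[OF q(2)] by (simp add: theta_def qpochs_def field_simps)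
  moreover have "integral\<^sup>L M (jacobi_term z q) = infsum (jacobi_term z q) UNIV"
    using int_jt infsetsum_infsum[of "jacobi_term z q" UNIV]
    by (simp add: M_def Infinite_Set_Sum.abs_summable_on_def infsetsum_def)
  moreover have "jacobi_term z q summable_on UNIV"
    using abs_summable_jacobi_term[OF q z] by (simp add: abs_summable_summable)
  ultimately show ?thesis
    by (metis has_sum_infsum)
qed

section \<open>The quintuple product\<close>

text \<open>Unordered summability of complex families is absolute, so the norms are summable over
  the product set by iterated summation.\<close>

lemma has_sum_product:
  fixes f :: "'a \<Rightarrow> complex" and g :: "'b \<Rightarrow> complex"
  assumes f: "(f has_sum a) A" and g: "(g has_sum b) B"
  shows "((\<lambda>(x, y). f x * g y) has_sum a * b) (A \<times> B)"
proof (rule has_sum_SigmaI)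
  show "((\<lambda>y. case (x, y) of (x, y) \<Rightarrow> f x * g y) has_sum f x * b) B" for x
    using has_sum_cmult_right[OF g, of "f x"] by simp
  show "((\<lambda>x. f x * b) has_sum a * b) A"
    by (rule has_sum_cmult_left[OF f])
  have f': "(\<lambda>x. norm (f x)) summable_on A" and g': "(\<lambda>y. norm (g y)) summable_on B"
    using assms has_sum_imp_summable summable_on_iff_abs_summable_on_complex by blast+
  have "(\<lambda>p. norm (case p of (x, y) \<Rightarrow> f x * g y)) summable_on A \<times> B"
  proof (subst Infinite_Sum.abs_summable_on_Sigma_iff, intro conjI ballI)
    show "(\<lambda>y. norm (case (x, y) of (x, y) \<Rightarrow> f x * g y)) summable_on B" for x
      using summable_on_cmult_right[OF g', of "norm (f x)"] by (simp add: norm_mult)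
    have "(\<lambda>x. norm (f x) * infsum (\<lambda>y. norm (g y)) B) summable_on A"
      by (rule summable_on_cmult_left[OF f'])
    then show "(\<lambda>x. norm (\<Sum>\<^sub>\<infinity>y\<in>B. norm (case (x, y) of (x, y) \<Rightarrow> f x * g y))) summable_on A"
      using g' by (simp add: norm_mult infsum_cmult_right infsum_nonneg abs_mult)
  qed
  then show "(\<lambda>(x, y). f x * g y) summable_on A \<times> B"
    by (rule abs_summable_summable)
qed

section \<open>Rearranged q-products and special values of theta\<close>

lemma qpoch_shift:
  assumes "norm q < 1"
  shows "qpoch z q = (1 - z) * qpoch (z * q) q"
proof -
  have "(\<lambda>n. \<Prod>j<Suc n. 1 - z * q ^ j) \<longlonglongrightarrow> qpoch z q"
    using qpoch_tendsto[OF assms] by (rule LIMSEQ_Suc)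
  moreover have "(\<lambda>n. (1 - z) * (\<Prod>j<n. 1 - z * q * q ^ j)) \<longlonglongrightarrow> (1 - z) * qpoch (z * q) q"
    by (intro tendsto_mult tendsto_const qpoch_tendsto assms)
  moreover have "(\<Prod>j<Suc n. 1 - z * q ^ j) = (1 - z) * (\<Prod>j<n. 1 - z * q * q ^ j)" for n
    by (subst prod.lessThan_Suc_shift) (simp add: mult.assoc)
  ultimately show ?thesis
    using LIMSEQ_unique by simp
qed

lemma norm_cube_less_1: "norm (q :: complex) < 1 \<Longrightarrow> norm (q ^ 3) < 1"
  by (simp add: norm_power power_less_one_iff)

lemma qpoch_trisect:
  assumes "norm q < 1"
  shows "qpoch z q = qpoch z (q ^ 3) * qpoch (z * q) (q ^ 3) * qpoch (z * q ^ 2) (q ^ 3)"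
proof -
  have "(\<lambda>n. \<Prod>j<3 * n. 1 - z * q ^ j) \<longlonglongrightarrow> qpoch z q"
    by (rule filterlim_compose[OF qpoch_tendsto[OF assms]])
       (rule filterlim_at_top_mono[OF filterlim_ident], simp)
  moreover have "(\<lambda>n. (\<Prod>j<n. 1 - z * (q ^ 3) ^ j) * (\<Prod>j<n. 1 - z * q * (q ^ 3) ^ j) *
      (\<Prod>j<n. 1 - z * q ^ 2 * (q ^ 3) ^ j))
    \<longlonglongrightarrow> qpoch z (q ^ 3) * qpoch (z * q) (q ^ 3) * qpoch (z * q ^ 2) (q ^ 3)"
    by (intro tendsto_mult qpoch_tendsto norm_cube_less_1 assms)
  moreover have "(\<Prod>j<3 * n. 1 - z * q ^ j) = (\<Prod>j<n. 1 - z * (q ^ 3) ^ j) *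
      (\<Prod>j<n. 1 - z * q * (q ^ 3) ^ j) * (\<Prod>j<n. 1 - z * q ^ 2 * (q ^ 3) ^ j)" for n
  proof (induction n)
    case (Suc n)
    have "3 * Suc n = Suc (Suc (Suc (3 * n)))" by simp
    then show ?case
      by (simp only: prod.lessThan_Suc Suc.IH) (simp add: power_mult[symmetric] power2_eq_square mult_ac)
  qed simp
  ultimately show ?thesis
    using LIMSEQ_unique by simp
qed

text \<open>Both are the splitting of \<open>qpoch q q\<close> into the classes \<open>q\<close>,
  \<open>q ^ 2\<close>, \<open>q ^ 3\<close> with base \<open>q ^ 3\<close>; passing from
  \<open>q\<close> to \<open>q ^ 2\<close> only swaps two factors.\<close>

lemma theta_cube_base:
  assumes "0 < norm q" "norm q < 1"
  shows "theta q (q ^ 3) = qpoch q q" "theta (q ^ 2) (q ^ 3) = qpoch q q"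
proof -
  have "q ^ 3 / q = q ^ 2" "q ^ 3 / q ^ 2 = q" "q * q = q ^ 2" "q * q ^ 2 = q ^ 3"
    using assms by (auto simp: field_simps eval_nat_numeral)
  then show "theta q (q ^ 3) = qpoch q q" "theta (q ^ 2) (q ^ 3) = qpoch q q"
    using qpoch_trisect[OF assms(2), of q] by (simp_all add: theta_def qpochs_def)
qed

lemma theta_1: "norm q < 1 \<Longrightarrow> theta 1 q = 0"
  using qpoch_shift[of q 1] by (simp add: theta_def qpochs_def)

lemma theta_inverse:
  assumes "norm q < 1" "z \<noteq> 0"
  shows "theta (1 / z) q = - theta z q / z"
proof -
  define X where "X = qpoch (q / z) q * qpoch (z * q) q * qpoch q q"
  have 1: "theta (1 / z) q = (1 - 1 / z) * X"
    using qpoch_shift[OF assms(1), of "1 / z"] by (simp add: X_def theta_def qpochs_def mult_ac)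
  have 2: "theta z q = (1 - z) * X"
    using qpoch_shift[OF assms(1), of z] by (simp add: X_def theta_def qpochs_def mult_ac)
  show ?thesis
    unfolding 1 2 using assms(2) by (simp add: field_simps)
qed

text \<open>The recursion determines all coefficients from \<open>c 0\<close>, \<open>c 1\<close>,
  \<open>c 2\<close>, and the triple product sums each residue class of \<open>N\<close> modulo 3.
  This serves both the quintuple product and Winquist's identity.\<close>

lemma laurent_step_three:
  fixes c :: "int \<Rightarrow> complex"
  assumes q: "0 < norm q" "norm q < 1" and z: "z \<noteq> 0" and w: "w \<noteq> 0"
    and S: "((\<lambda>N. c N * z powi N) has_sum S) UNIV"
    and rec: "\<And>N. c (N + 3) = w * q powi N * c N"
  shows "S = c 0 * theta (- (w * z ^ 3)) (q ^ 3) + c 1 * z * theta (- (w * z ^ 3 * q)) (q ^ 3)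
    + c 2 * z ^ 2 * theta (- (w * z ^ 3 * q ^ 2)) (q ^ 3)"
proof -
  have q0: "q \<noteq> 0" using q by auto
  \<comment> \<open>Solution of the recursion in both directions; for \<open>t > 0\<close> it is the
    product of the factors \<open>w * q powi (3 * s + r)\<close> with
    \<open>0 \<le> s < t\<close>.\<close>
  have c_eq: "c (3 * t + r) = w powi t * q powi (3 * tri t + r * t) * c r" for t r
  proof (induction t rule: int_induct[where k = 0])
    case (step1 i)
    have "c (3 * (i + 1) + r) = w * q powi (3 * i + r) * c (3 * i + r)"
      using rec[of "3 * i + r"] by (simp add: algebra_simps)
    then show ?case
      using step1 q0 w by (simp add: power_int_add tri_add_1 distrib_left mult_ac)
  next
    case (step2 i)
    define j where "j = i - 1"
    have i: "i = j + 1" by (simp add: j_def)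
    have "c (3 * i + r) = w * q powi (3 * j + r) * c (3 * j + r)"
      using rec[of "3 * j + r"] by (simp add: algebra_simps i)
    then show ?case
      using step2 q0 w unfolding j_def[symmetric] unfolding i
      by (simp add: power_int_add tri_add_1 distrib_left mult_ac)
  qed simp
  have part: "((\<lambda>N. c N * z powi N) has_sum
      c (int r) * z ^ r * theta (- (w * z ^ 3 * q ^ r)) (q ^ 3)) {N. N mod 3 = int r}"
    if r: "r < 3" for r :: nat
  proof -
    have "(jacobi_term (- (w * z ^ 3 * q ^ r)) (q ^ 3) has_sum
        theta (- (w * z ^ 3 * q ^ r)) (q ^ 3)) UNIV"
      using q z w q0 by (intro jacobi_triple_product norm_cube_less_1) auto
    from has_sum_cmult_right[OF this]
    have "((\<lambda>t. c (int r) * z ^ r * jacobi_term (- (w * z ^ 3 * q ^ r)) (q ^ 3) t) has_sum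
        c (int r) * z ^ r * theta (- (w * z ^ 3 * q ^ r)) (q ^ 3)) UNIV" .
    also have "(\<lambda>t. c (int r) * z ^ r * jacobi_term (- (w * z ^ 3 * q ^ r)) (q ^ 3) t) =
        (\<lambda>t. c (3 * t + int r) * z powi (3 * t + int r))"
    proof
      fix t
      \<comment> \<open>The sign coming from the minus in the theta argument cancels the one in
        \<open>jacobi_term\<close>.\<close>
      have "(- (w * z ^ 3 * q ^ r)) powi t = (- 1) powi t * w powi t * z powi (3 * t) * q powi (int r * t)"
        using power_int_mult_distrib[of "- 1" "w * z ^ 3 * q ^ r" t]
        by (simp add: power_int_mult_distrib power_int_power mult_ac)
      moreover have "(- 1 :: complex) powi t * (- 1) powi t = 1"
        by (simp flip: power_int_mult_distrib)
      ultimately show "c (int r) * z ^ r * jacobi_term (- (w * z ^ 3 * q ^ r)) (q ^ 3) t =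
          c (3 * t + int r) * z powi (3 * t + int r)"
        using q0 z by (simp add: c_eq jacobi_term_def power_int_power power_int_add)
    qed
    finally have "((\<lambda>t. c (3 * t + int r) * z powi (3 * t + int r)) has_sum
        c (int r) * z ^ r * theta (- (w * z ^ 3 * q ^ r)) (q ^ 3)) UNIV" .
    moreover have "3 * (N div 3) + int r = N" if "N mod 3 = int r" for N
      using mult_div_mod_eq[of 3 N] that by simp
    ultimately show ?thesis
      by (subst has_sum_reindex_bij_witness[of _ "\<lambda>t. 3 * t + int r" "\<lambda>N. N div 3" UNIV
            "\<lambda>t. c (3 * t + int r) * z powi (3 * t + int r)"])
         (use r in auto)
  qed
  have "((\<lambda>N. c N * z powi N) has_sum
      c 0 * theta (- (w * z ^ 3)) (q ^ 3) + c 1 * z * theta (- (w * z ^ 3 * q)) (q ^ 3)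
      + c 2 * z ^ 2 * theta (- (w * z ^ 3 * q ^ 2)) (q ^ 3))
      ({N. N mod 3 = 0} \<union> {N. N mod 3 = 1} \<union> {N. N mod 3 = 2})"
    using part[of 0] part[of 1] part[of 2] by (intro has_sum_Un_disjoint) auto
  also have "{N. N mod 3 = 0} \<union> {N. N mod 3 = 1} \<union> {N. N mod 3 = 2} = (UNIV :: int set)"
    by auto
  finally show ?thesis
    using S has_sum_unique by blast
qed

text \<open>Expands \<open>theta z q * theta (q * z\<^sup>2) (q\<^sup>2)\<close>, which is the
  quintuple product times \<open>qpoch (q\<^sup>2) (q\<^sup>2)\<close>, in powers of
  \<open>z\<close>. The coefficients obey a step-three recursion, and the three initial ones are
  again triple products.\<close>

theorem quintuple_product:
  assumes q: "0 < norm q" "norm q < 1" and z: "z \<noteq> 0"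
  shows "quintuple z q = theta (- (z ^ 3 * q)) (q ^ 3) - z * theta (- (z ^ 3 * q ^ 2)) (q ^ 3)"
proof -
  have q0: "q \<noteq> 0" using q by auto
  have q2: "0 < norm (q\<^sup>2)" "norm (q\<^sup>2) < 1"
    using q by (auto simp: norm_power power_less_one_iff)
  have q6: "0 < norm ((q\<^sup>2) ^ 3)" "norm ((q\<^sup>2) ^ 3) < 1"
    using q2 norm_cube_less_1[of "q\<^sup>2"] by auto
  \<comment> \<open>Contribution of \<open>i = N - 2 * j\<close> to the coefficient of
    \<open>z powi N\<close>; the exponent \<open>j * j\<close> is \<open>2 * tri j + j\<close>, from
    base \<open>q\<^sup>2\<close> and argument \<open>q * z\<^sup>2\<close>.\<close>
  define u where "u = (\<lambda>N j. (- 1) powi (N - j) * q powi (tri (N - 2 * j) + j * j))"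
  define c where "c = (\<lambda>N. infsum (u N) UNIV)"
  have "((\<lambda>(i, j). jacobi_term z q i * jacobi_term (q * z\<^sup>2) (q\<^sup>2) j) has_sum
      theta z q * theta (q * z\<^sup>2) (q\<^sup>2)) (UNIV \<times> UNIV)"
    using q q2 z q0 by (intro has_sum_product jacobi_triple_product) auto
  also have "?this \<longleftrightarrow> ((\<lambda>(N, j). u N j * z powi N) has_sum
      theta z q * theta (q * z\<^sup>2) (q\<^sup>2)) (UNIV \<times> UNIV)"
  proof (rule has_sum_reindex_bij_witness[of _ "\<lambda>(N, j). (N - 2 * j, j)" "\<lambda>(i, j). (i + 2 * j, j)"])
    fix ij :: "int \<times> int"
    obtain i j where ij: "ij = (i, j)" by force
    have "tri j * 2 + j = j * j"
      using two_tri[of j] by (simp add: algebra_simps)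
    then have "q powi (tri i + j * j) = q powi tri i * ((q\<^sup>2) powi tri j * q powi j)"
      using q0 by (simp add: power_int_power flip: power_int_add) (simp add: algebra_simps)
    moreover have "(- 1 :: complex) powi (j + i) = (- 1) powi i * (- 1) powi j"
      by (subst power_int_add) simp_all
    moreover have "z powi (i + 2 * j) = z powi i * (z\<^sup>2) powi j"
      using z by (simp add: power_int_power power_int_add)
    ultimately show "(case (case ij of (i, j) \<Rightarrow> (i + 2 * j, j)) of (N, j) \<Rightarrow> u N j * z powi N) =
        (case ij of (i, j) \<Rightarrow> jacobi_term z q i * jacobi_term (q * z\<^sup>2) (q\<^sup>2) j)"
      by (simp add: ij u_def jacobi_term_def power_int_mult_distrib mult_ac)
  qed auto
  finally have sum: "((\<lambda>(N, j). u N j * z powi N) has_sum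
      theta z q * theta (q * z\<^sup>2) (q\<^sup>2)) (UNIV \<times> UNIV)" .
  have "(\<lambda>j. u N j * z powi N) summable_on UNIV" for N
    using summable_on_SigmaD1[OF has_sum_imp_summable[OF sum]] by simp
  then have "u N summable_on UNIV" for N
    using z summable_on_cmult_left'[of "z powi N" "u N" UNIV] by simp
  then have inner: "((\<lambda>j. u N j * z powi N) has_sum c N * z powi N) UNIV" for N
    unfolding c_def by (intro has_sum_cmult_left has_sum_infsum)
  have "((\<lambda>N. c N * z powi N) has_sum theta z q * theta (q * z\<^sup>2) (q\<^sup>2)) UNIV"
    by (rule has_sum_SigmaD[OF sum]) (use inner in simp)
  moreover have "c (N + 3) = q * q powi N * c N" for N
  proof -
    \<comment> \<open>Raising \<open>i\<close> and \<open>j\<close> by 1 each raises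
      \<open>N = i + 2 * j\<close> by 3.\<close>
    have "infsum (u (N + 3)) UNIV = infsum (\<lambda>j. q * q powi N * u N j) UNIV"
    proof (rule infsum_reindex_bij_witness[of _ "\<lambda>j. j + 1" "\<lambda>j. j - 1"])
      fix j
      define i where "i = N - 2 * (j - 1)"
      have "tri (N + 3 - 2 * j) = tri i + i"
        using tri_add_1[of i] by (simp add: i_def algebra_simps)
      then have "tri (N + 3 - 2 * j) + j * j = 1 + N + (tri i + (j - 1) * (j - 1))"
        by (simp add: i_def algebra_simps)
      moreover have "(- 1 :: complex) powi (N + 3 - j) = (- 1) powi (N - (j - 1))"
        using power_int_add[of "- 1 :: complex" "N - (j - 1)" 2] by (simp add: algebra_simps)
      moreover have "q powi (1 + N + x) = q * q powi N * q powi x" for x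
        using q0 by (simp add: power_int_add)
      ultimately show "q * q powi N * u N (j - 1) = u (N + 3) j"
        unfolding u_def i_def[symmetric] by simp
    qed auto
    then show ?thesis
      by (simp add: c_def infsum_cmult_right')
  qed
  ultimately have main: "theta z q * theta (q * z\<^sup>2) (q\<^sup>2) =
      c 0 * theta (- (q * z ^ 3)) (q ^ 3) + c 1 * z * theta (- (q * z ^ 3 * q)) (q ^ 3)
      + c 2 * z ^ 2 * theta (- (q * z ^ 3 * q ^ 2)) (q ^ 3)"
    by (intro laurent_step_three q z q0)
  have JTP: "infsum (jacobi_term x ((q\<^sup>2) ^ 3)) UNIV = theta x ((q\<^sup>2) ^ 3)" if "x \<noteq> 0" for x
    using jacobi_triple_product[OF q6 that] by (rule infsumI)
  \<comment> \<open>Up to a sign or a factor \<open>q\<close>, the coefficients \<open>c 0\<close>,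
    \<open>c 1\<close>, \<open>c 2\<close> are theta values of base \<open>q ^ 6\<close> at
    \<open>q ^ 4\<close>, \<open>q ^ 2\<close> and 1; \<open>theta_cube_base\<close> evaluates the
    first two and the third vanishes.\<close>
  have "u 0 j = jacobi_term ((q\<^sup>2)\<^sup>2) ((q\<^sup>2) ^ 3) j" for j
  proof -
    have "tri (0 - 2 * j) + j * j = 6 * tri j + 4 * j"
      using two_tri[of j] by (subst tri_eqI[of "2 * j * j + j"]) (auto simp: algebra_simps)
    moreover have "(- 1 :: complex) powi (0 - j) = (- 1) powi j"
      by (simp add: power_int_minus flip: power_int_inverse)
    moreover have "q powi (6 * tri j + 4 * j) = ((q\<^sup>2) ^ 3) powi tri j * ((q\<^sup>2)\<^sup>2) powi j"
      using q0 by (simp add: power_int_power power_int_add flip: power_mult)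
    ultimately show ?thesis
      unfolding u_def jacobi_term_def by simp
  qed
  then have "u 0 = jacobi_term ((q\<^sup>2)\<^sup>2) ((q\<^sup>2) ^ 3)"
    by (rule ext)
  then have c0: "c 0 = qpoch (q\<^sup>2) (q\<^sup>2)"
    using JTP[of "(q\<^sup>2)\<^sup>2"] q0 theta_cube_base(2)[OF q2] by (simp add: c_def)
  have "u 1 j = - jacobi_term (q\<^sup>2) ((q\<^sup>2) ^ 3) j" for j
  proof -
    have "tri (1 - 2 * j) + j * j = 6 * tri j + 2 * j"
      using two_tri[of j] by (subst tri_eqI[of "2 * j * j - j"]) (auto simp: algebra_simps)
    moreover have "(- 1 :: complex) powi (1 - j) = - ((- 1) powi j)"
      by (simp add: power_int_diff flip: power_int_inverse inverse_eq_divide)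
    moreover have "q powi (6 * tri j + 2 * j) = ((q\<^sup>2) ^ 3) powi tri j * (q\<^sup>2) powi j"
      using q0 by (simp add: power_int_power power_int_add flip: power_mult)
    ultimately show ?thesis
      unfolding u_def jacobi_term_def by simp
  qed
  then have "u 1 = (\<lambda>j. - jacobi_term (q\<^sup>2) ((q\<^sup>2) ^ 3) j)"
    by (rule ext)
  then have c1: "c 1 = - qpoch (q\<^sup>2) (q\<^sup>2)"
    using JTP[of "q\<^sup>2"] q0 theta_cube_base(1)[OF q2] by (simp add: c_def infsum_uminus)
  have "u 2 j = q * jacobi_term 1 ((q\<^sup>2) ^ 3) j" for j
  proof -
    have "tri (2 - 2 * j) + j * j = 1 + 6 * tri j"
      using two_tri[of j] by (subst tri_eqI[of "2 * j * j - 3 * j + 1"]) (auto simp: algebra_simps)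
    moreover have "(- 1 :: complex) powi (2 - j) = (- 1) powi j"
      by (simp add: power_int_diff flip: power_int_inverse inverse_eq_divide)
    moreover have "q powi (1 + 6 * tri j) = q * ((q\<^sup>2) ^ 3) powi tri j"
      using q0 by (simp add: power_int_power power_int_add flip: power_mult)
    ultimately show ?thesis
      unfolding u_def jacobi_term_def by simp
  qed
  then have "u 2 = (\<lambda>j. q * jacobi_term 1 ((q\<^sup>2) ^ 3) j)"
    by (rule ext)
  then have c2: "c 2 = 0"
    using JTP[of 1] theta_1[OF q6(2)] by (simp add: c_def infsum_cmult_right')
  have "q\<^sup>2 / (q * z\<^sup>2) = q / z\<^sup>2"
    using q0 by (simp add: power2_eq_square)
  then have "theta z q * theta (q * z\<^sup>2) (q\<^sup>2) = qpoch (q\<^sup>2) (q\<^sup>2) * quintuple z q"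
    by (simp add: theta_def qpochs_def quintuple_def mult_ac)
  with main have "qpoch (q\<^sup>2) (q\<^sup>2) * quintuple z q = qpoch (q\<^sup>2) (q\<^sup>2) *
      (theta (- (z ^ 3 * q)) (q ^ 3) - z * theta (- (z ^ 3 * q ^ 2)) (q ^ 3))"
    by (simp add: c0 c1 c2 algebra_simps power2_eq_square)
  then show ?thesis
    using qpoch_q_q_nonzero[OF q2(2)] by simp
qed

section \<open>Winquist's identity\<close>

text \<open>What the residue classes 1 and 2 of the Laurent series in \<open>a\<close> combine to,
  after a factor \<open>a\<close> is taken out, once their coefficients are opposite.\<close>

definition winquist_factor :: "complex \<Rightarrow> complex \<Rightarrow> complex" where
  "winquist_factor q a = theta (a ^ 3 * q) (q ^ 3) - a * theta (a ^ 3 * q\<^sup>2) (q ^ 3)"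

text \<open>As a series in \<open>a\<close> the product falls under
  \<open>laurent_step_three\<close> with \<open>w = - 1\<close>, and a reflection of the index pairs
  gives \<open>c 2 = - c 1\<close>. It matters that \<open>c0\<close> and \<open>c1\<close> do not
  depend on \<open>a\<close>.\<close>

lemma theta_triple_expansion:
  assumes q: "0 < norm q" "norm q < 1" and b: "b \<noteq> 0"
  obtains c0 c1 where "\<And>a. a \<noteq> 0 \<Longrightarrow> theta a q * theta (a * b) q * theta (a / b) q =
    c0 * theta (a ^ 3) (q ^ 3) + c1 * a * winquist_factor q a"
proof -
  have q0: "q \<noteq> 0" using q by auto
  \<comment> \<open>Contribution of \<open>i = N - j - k\<close> to the coefficient of
    \<open>a powi N\<close>.\<close>
  define u :: "int \<Rightarrow> int \<times> int \<Rightarrow> complex" where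
    "u = (\<lambda>N (j, k). (- 1) powi N * q powi (tri (N - j - k) + tri j + tri k) * b powi (j - k))"
  define c where "c = (\<lambda>N. infsum (u N) UNIV)"
  have rec: "c (N + 3) = - 1 * q powi N * c N" for N
  proof -
    have "infsum (u (N + 3)) UNIV = infsum (\<lambda>x. - 1 * q powi N * u N x) UNIV"
    proof (rule infsum_reindex_bij_witness[of _ "\<lambda>(j, k). (j + 1, k + 1)" "\<lambda>(j, k). (j - 1, k - 1)"])
      fix x :: "int \<times> int"
      obtain j k where x: "x = (j + 1, k + 1)"
        by (metis diff_add_cancel surj_pair)
      have "tri (N + 3 - (j + 1) - (k + 1)) = tri (N - j - k) + (N - j - k)"
        using tri_add_1[of "N - j - k"] by (simp add: algebra_simps)
      then have "tri (N + 3 - (j + 1) - (k + 1)) + tri (j + 1) + tri (k + 1) =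
          N + (tri (N - j - k) + tri j + tri k)"
        by (simp add: tri_add_1)
      moreover have "(- 1 :: complex) powi (N + 3) = - ((- 1) powi N)"
        by (simp add: power_int_add)
      moreover have "q powi (N + y) = q powi N * q powi y" for y
        using q0 by (simp add: power_int_add)
      ultimately show "- 1 * q powi N * u N (case x of (j, k) \<Rightarrow> (j - 1, k - 1)) = u (N + 3) x"
        unfolding x u_def prod.case by simp
    qed auto
    then show ?thesis
      unfolding c_def by (simp only: infsum_cmult_right')
  qed
  have "c 2 = - c 1"
  proof -
    \<comment> \<open>Sending \<open>(j, k)\<close> to \<open>(1 - k, 1 - j)\<close> keeps
      \<open>j - k\<close> and, by \<open>tri_reflect\<close>, the sum of the triangular exponents;
      only the sign \<open>(- 1) powi N\<close> changes.\<close>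
    have "infsum (u 2) UNIV = infsum (\<lambda>x. - u 1 x) UNIV"
    proof (rule infsum_reindex_bij_witness[of _ "\<lambda>(j, k). (1 - k, 1 - j)" "\<lambda>(j, k). (1 - k, 1 - j)"])
      fix x :: "int \<times> int"
      obtain j k where x: "x = (j, k)" by force
      have "tri (1 - (1 - k) - (1 - j)) = tri (2 - j - k)"
        using tri_reflect[of "2 - j - k"] by (simp add: algebra_simps)
      then show "- u 1 (case x of (j, k) \<Rightarrow> (1 - k, 1 - j)) = u 2 x"
        by (simp add: x u_def tri_reflect add_ac)
    qed auto
    then show ?thesis
      by (simp add: c_def infsum_uminus)
  qed
  moreover have "theta a q * theta (a * b) q * theta (a / b) q =
      c 0 * theta (- (- 1 * a ^ 3)) (q ^ 3) + c 1 * a * theta (- (- 1 * a ^ 3 * q)) (q ^ 3)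
      + c 2 * a ^ 2 * theta (- (- 1 * a ^ 3 * q ^ 2)) (q ^ 3)" if a: "a \<noteq> 0" for a
  proof (intro laurent_step_three q a rec)
    define S where "S = theta a q * theta (a * b) q * theta (a / b) q"
    have "((\<lambda>(i, x). jacobi_term a q i * (case x of (j, k) \<Rightarrow> jacobi_term (a * b) q j * jacobi_term (a / b) q k))
        has_sum theta a q * (theta (a * b) q * theta (a / b) q)) (UNIV \<times> (UNIV \<times> UNIV))"
      using q a b q0 by (intro has_sum_product jacobi_triple_product) auto
    also have "?this \<longleftrightarrow> ((\<lambda>(N, x). u N x * a powi N) has_sum S) (UNIV \<times> (UNIV \<times> UNIV))"
    proof (rule has_sum_reindex_bij_witness[of _ "\<lambda>(N, j, k). (N - j - k, j, k)" "\<lambda>(i, j, k). (i + j + k, j, k)"])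
      fix x :: "int \<times> int \<times> int"
      obtain i j k where x: "x = (i, j, k)" using prod_cases3 by blast
      show "(case (case x of (i, j, k) \<Rightarrow> (i + j + k, j, k)) of (N, x) \<Rightarrow> u N x * a powi N) =
          (case x of (i, x) \<Rightarrow> jacobi_term a q i * (case x of (j, k) \<Rightarrow> jacobi_term (a * b) q j * jacobi_term (a / b) q k))"
        using a b q0
        by (simp add: x u_def jacobi_term_def power_int_add power_int_diff power_int_mult_distrib
              power_int_divide_distrib)
    qed (auto simp: S_def)
    finally have sum: "((\<lambda>(N, x). u N x * a powi N) has_sum S) (UNIV \<times> UNIV)" by simp
    have "(\<lambda>x. u N x * a powi N) summable_on UNIV" for N
      using summable_on_SigmaD1[OF has_sum_imp_summable[OF sum]] by simp
    then have "u N summable_on UNIV" for N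
      using a summable_on_cmult_left'[of "a powi N" "u N" UNIV] by simp
    then have "((\<lambda>x. u N x * a powi N) has_sum c N * a powi N) UNIV" for N
      unfolding c_def by (intro has_sum_cmult_left has_sum_infsum)
    then show "((\<lambda>N. c N * a powi N) has_sum S) UNIV"
      by (intro has_sum_SigmaD[OF sum]) simp
  qed simp
  ultimately show ?thesis
    using that[of "c 0" "c 1"] by (simp add: winquist_factor_def algebra_simps power2_eq_square)
qed

section \<open>Cube roots of unity and the proof of Winquist's identity\<close>

lemma cube_root_of_unity_cubed:
  fixes w :: complex
  assumes "1 + w + w\<^sup>2 = 0"
  shows "w ^ 3 = 1"
proof -
  have "w ^ 3 - 1 = (w - 1) * (1 + w + w\<^sup>2)"
    by (simp add: algebra_simps power2_eq_square power3_eq_cube)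
  then show ?thesis by (simp add: assms)
qed

text \<open>Factor by factor this is
  \<open>(1 - x) * (1 - w * x) * (1 - w\<^sup>2 * x) = 1 - x ^ 3\<close>, applied to partial
  products.\<close>

lemma qpoch_cube_root_of_unity:
  assumes "norm q < 1" and w: "1 + w + w\<^sup>2 = 0"
  shows "qpoch z q * qpoch (w * z) q * qpoch (w\<^sup>2 * z) q = qpoch (z ^ 3) (q ^ 3)"
proof -
  have fact: "(1 - x) * (1 - w * x) * (1 - w\<^sup>2 * x) = 1 - x ^ 3" for x
  proof -
    have "(1 - w * x) * (1 - w\<^sup>2 * x) = 1 - (1 + w + w\<^sup>2) * x + x + w ^ 3 * x\<^sup>2"
      by (simp add: algebra_simps power2_eq_square power3_eq_cube)
    also have "\<dots> = 1 + x + x\<^sup>2"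
      by (simp add: w cube_root_of_unity_cubed[OF w])
    finally show ?thesis
      unfolding mult.assoc by (simp add: algebra_simps power2_eq_square power3_eq_cube)
  qed
  have "(\<lambda>n. (\<Prod>j<n. 1 - z * q ^ j) * (\<Prod>j<n. 1 - w * z * q ^ j) * (\<Prod>j<n. 1 - w\<^sup>2 * z * q ^ j))
      \<longlonglongrightarrow> qpoch z q * qpoch (w * z) q * qpoch (w\<^sup>2 * z) q"
    by (intro tendsto_mult qpoch_tendsto assms)
  moreover have "(\<lambda>n. \<Prod>j<n. 1 - z ^ 3 * (q ^ 3) ^ j) \<longlonglongrightarrow> qpoch (z ^ 3) (q ^ 3)"
    by (intro qpoch_tendsto norm_cube_less_1 assms)
  moreover have "(\<Prod>j<n. 1 - z * q ^ j) * (\<Prod>j<n. 1 - w * z * q ^ j) * (\<Prod>j<n. 1 - w\<^sup>2 * z * q ^ j)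
      = (\<Prod>j<n. 1 - z ^ 3 * (q ^ 3) ^ j)" for n
    unfolding prod.distrib[symmetric]
  proof (rule prod.cong)
    fix j
    show "(1 - z * q ^ j) * (1 - w * z * q ^ j) * (1 - w\<^sup>2 * z * q ^ j) = 1 - z ^ 3 * (q ^ 3) ^ j"
      using fact[of "z * q ^ j"]
      by (simp add: mult.assoc power_mult_distrib power_mult[symmetric] mult.commute[of j])
  qed simp
  ultimately show ?thesis
    using LIMSEQ_unique by simp
qed

lemma ex_cube_root_of_unity: "\<exists>w::complex. 1 + w + w\<^sup>2 = 0"
proof
  show "1 + Complex (- 1 / 2) (sqrt 3 / 2) + (Complex (- 1 / 2) (sqrt 3 / 2))\<^sup>2 = 0"
    by (simp add: complex_eq_iff power2_eq_square)
qed

theorem winquist: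
  assumes q: "0 < norm q" "norm q < 1" and "a \<noteq> 0" "b \<noteq> 0"
  shows "W a b q = theta (a ^ 3) (q ^ 3) * winquist_factor q b
    - a / b * theta (b ^ 3) (q ^ 3) * winquist_factor q a"
proof -
  define h where "h = winquist_factor q"
  define \<theta> where "\<theta> = (\<lambda>x. theta (x ^ 3) (q ^ 3))"
  define E where "E = qpoch q q"
  have E: "E \<noteq> 0" using qpoch_q_q_nonzero[OF q(2)] by (simp add: E_def)
  have q0: "q \<noteq> 0" using q by auto
  obtain w :: complex where w: "1 + w + w\<^sup>2 = 0"
    using ex_cube_root_of_unity by blast
  have w3: "w ^ 3 = 1" by (rule cube_root_of_unity_cubed[OF w])
  have w0: "w \<noteq> 0" and w1: "w \<noteq> 1"
    using w by auto
  have W_eq: "W a b q = theta b q * (theta a q * theta (a * b) q * theta (a / b) q) / E\<^sup>2" for a b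
    by (simp add: W_def thetas_def E_def power_int_minus field_simps)
  have "\<exists>g. \<forall>a. a \<noteq> 0 \<longrightarrow> W a b q = g * \<theta> a - a / b * \<theta> b * h a" if b: "b \<noteq> 0" for b
  proof -
    obtain c0 c1 where c: "\<And>a. a \<noteq> 0 \<Longrightarrow> theta a q * theta (a * b) q * theta (a / b) q =
        c0 * \<theta> a + c1 * a * h a"
      using theta_triple_expansion[OF q b] unfolding \<theta>_def h_def by blast
    \<comment> \<open>Since \<open>w ^ 3 = 1\<close>, the point \<open>a = w\<close> kills the
      \<open>c0\<close> term and isolates \<open>c1\<close>.\<close>
    have "\<theta> w = 0" "h w = (1 - w) * E"
      using theta_1[OF norm_cube_less_1[OF q(2)]] theta_cube_base[OF q]
      by (simp_all add: \<theta>_def h_def winquist_factor_def w3 E_def algebra_simps)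
    then have 1: "theta b q * (theta w q * theta (w * b) q * theta (w / b) q) = (1 - w) * w * E * (theta b q * c1)"
      unfolding c[OF w0] by simp
    \<comment> \<open>Once \<open>qpoch w q\<close> has given up its factor \<open>1 - w\<close>,
      the products at \<open>q\<close>, \<open>w * q\<close> and \<open>w\<^sup>2 * q\<close>
      remain.\<close>
    have 2: "theta w q = (1 - w) * qpoch (q ^ 3) (q ^ 3)"
    proof -
      have "q / w = w\<^sup>2 * q" using w0 w3 by (simp add: divide_eq_eq power2_eq_square power3_eq_cube mult_ac)
      then show ?thesis
        using qpoch_cube_root_of_unity[OF q(2) w, of q] qpoch_shift[OF q(2), of w]
        by (simp add: theta_def qpochs_def mult_ac)
    qed
    \<comment> \<open>Inverting \<open>w / b\<close> supplies the third conjugate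
      \<open>w\<^sup>2 * b\<close> of \<open>b\<close>.\<close>
    have 3: "theta (w / b) q = - (w / b) * theta (w\<^sup>2 * b) q"
    proof -
      have "w\<^sup>2 = 1 / w" using w0 w3 by (simp add: eq_divide_eq power2_eq_square power3_eq_cube mult_ac)
      then show ?thesis
        using theta_inverse[OF q(2), of "b / w"] b w0 by simp
    qed
    have 4: "theta b q * theta (w * b) q * theta (w\<^sup>2 * b) q * qpoch (q ^ 3) (q ^ 3) = \<theta> b * E ^ 3"
    proof -
      have "q / (w * b) = w\<^sup>2 * (q / b)" "q / (w\<^sup>2 * b) = w * (q / b)"
        using w0 w3 b by (simp_all add: divide_eq_eq power2_eq_square power3_eq_cube mult_ac)
      then have "theta b q * theta (w * b) q * theta (w\<^sup>2 * b) q =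
          (qpoch b q * qpoch (w * b) q * qpoch (w\<^sup>2 * b) q) *
          (qpoch (q / b) q * qpoch (w * (q / b)) q * qpoch (w\<^sup>2 * (q / b)) q) * E ^ 3"
        by (simp only: theta_def qpochs_def E_def power3_eq_cube list.map prod_list.Cons prod_list.Nil)
           (simp only: mult_ac mult_1_right mult_1_left)
      also have "\<dots> = qpoch (b ^ 3) (q ^ 3) * qpoch (q ^ 3 / b ^ 3) (q ^ 3) * E ^ 3"
        by (simp only: qpoch_cube_root_of_unity[OF q(2) w] power_divide)
      finally show ?thesis
        by (simp add: \<theta>_def theta_def qpochs_def mult_ac)
    qed
    have "theta b q * (theta w q * theta (w * b) q * theta (w / b) q) = (1 - w) * w * (- (1 / b)) *
        (theta b q * theta (w * b) q * theta (w\<^sup>2 * b) q * qpoch (q ^ 3) (q ^ 3))"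
      unfolding 2 3 by simp
    then have "(1 - w) * w * E * (theta b q * c1) = (1 - w) * w * E * (- (1 / b) * \<theta> b * E\<^sup>2)"
      unfolding 1 4 by (simp add: power2_eq_square power3_eq_cube)
    \<comment> \<open>Only \<open>theta b q * c1\<close> is found, which is what \<open>W\<close>
      contains; dividing by \<open>theta b q\<close> would fail at its zeros.\<close>
    then have c1: "theta b q * c1 = - (1 / b) * \<theta> b * E\<^sup>2"
      using w0 w1 E by (subst (asm) mult_left_cancel) auto
    have "W a b q = theta b q * c0 / E\<^sup>2 * \<theta> a - a / b * \<theta> b * h a" if "a \<noteq> 0" for a
    proof -
      have "W a b q = (theta b q * c0 * \<theta> a + (theta b q * c1) * a * h a) / E\<^sup>2"
        unfolding W_eq c[OF that] by (simp add: algebra_simps)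
      also have "\<dots> = theta b q * c0 / E\<^sup>2 * \<theta> a - a / b * \<theta> b * h a"
        unfolding c1 using E b by (simp add: field_simps)
      finally show ?thesis .
    qed
    then show ?thesis by blast
  qed
  then obtain g where g: "\<And>a b. a \<noteq> 0 \<Longrightarrow> b \<noteq> 0 \<Longrightarrow> W a b q = g b * \<theta> a - a / b * \<theta> b * h a"
    by metis
  \<comment> \<open>The antisymmetry of \<open>W\<close> under exchanging its arguments forces the remaining coefficient.\<close>
  have anti: "W b a q = - (b / a) * W a b q" if "a \<noteq> 0" "b \<noteq> 0" for a b
    using theta_inverse[OF q(2), of "a / b"] that by (simp add: W_eq mult_ac)
  \<comment> \<open>Expanding both sides of \<open>anti\<close> turns the antisymmetry of
    \<open>W\<close> into a relation for the difference \<open>g - h\<close> at any two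
    points.\<close>
  have key: "\<theta> b * (g a - h a) = - (b / a) * \<theta> a * (g b - h b)" if "a \<noteq> 0" "b \<noteq> 0" for a b
  proof -
    have "g a * \<theta> b - b / a * \<theta> a * h b = - (b / a) * (g b * \<theta> a) + (b / a) * (a / b) * (\<theta> b * h a)"
      using anti[OF that] unfolding g[OF that] g[OF that(2,1)]
      by (simp only: right_diff_distrib mult_ac) simp
    also have "(b / a) * (a / b) = 1" using that by simp
    finally show ?thesis
      by (simp add: algebra_simps diff_divide_distrib)
  qed
  \<comment> \<open>At \<open>b = a\<close> the relation says that a number equals its own
    negative.\<close>
  have gen: "g a = h a" if "a \<noteq> 0" "\<theta> a \<noteq> 0" for a
    using key[of a a] that by simp
  \<comment> \<open>One point where \<open>\<theta>\<close> does not vanish suffices: the relation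
    between \<open>b\<close> and \<open>- 1\<close> then covers the zeros of \<open>\<theta>\<close>
    as well.\<close>
  have "\<theta> (- 1) \<noteq> 0"
  proof -
    have nz: "1 + (q ^ 3) ^ j \<noteq> 0" for j
    proof (cases j)
      case (Suc i)
      then show ?thesis
        using norm_power_Suc_less_1[OF norm_cube_less_1[OF q(2)], of i]
        by (metis add_eq_0_iff norm_minus_cancel norm_one order_less_irrefl)
    qed simp
    have "1 - (- 1) * (q ^ 3) ^ j \<noteq> 0" "1 - (- (q ^ 3)) * (q ^ 3) ^ j \<noteq> 0" for j
      using nz[of j] nz[of "Suc j"] by simp_all
    then have "qpoch (- 1) (q ^ 3) \<noteq> 0" "qpoch (- (q ^ 3)) (q ^ 3) \<noteq> 0"
      using qpoch_nonzero[OF norm_cube_less_1[OF q(2)]] by blast+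
    then show ?thesis
      using qpoch_q_q_nonzero[OF norm_cube_less_1[OF q(2)]]
      by (simp add: \<theta>_def theta_def qpochs_def)
  qed
  then have "g b = h b"
    using key[of b "- 1"] gen[of "- 1"] \<open>b \<noteq> 0\<close> by simp
  then show ?thesis
    using g[OF \<open>a \<noteq> 0\<close> \<open>b \<noteq> 0\<close>] by (simp add: \<theta>_def h_def mult_ac)
qed

section \<open>Dissection along a Gaussian prime\<close>

lemma norm_power_int_less_1:
  fixes q :: complex
  assumes "0 < norm q" "norm q < 1" "0 < d"
  shows "0 < norm (q powi d)" "norm (q powi d) < 1"
proof -
  obtain k where "d = int (Suc k)"
    using assms(3) by (cases d rule: int_cases3) (auto simp: gr0_conv_Suc)
  then show "0 < norm (q powi d)" "norm (q powi d) < 1"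
    using assms norm_power_Suc_less_1[OF assms(2), of k] by (auto simp del: power_Suc of_nat_Suc)
qed

text \<open>The minus sign in the argument cancels the alternating sign of
  \<open>jacobi_term\<close>, leaving a series of plain powers of \<open>q\<close>.\<close>

lemma has_sum_theta_minus_powi:
  assumes q: "0 < norm q" "norm q < 1" and d: "0 < d"
  shows "((\<lambda>i. q powi (d * tri i + e * i)) has_sum theta (- (q powi e)) (q powi d)) UNIV"
proof -
  have q0: "q \<noteq> 0" using q by auto
  have "jacobi_term (- (q powi e)) (q powi d) i = q powi (d * tri i + e * i)" for i
  proof -
    have "(- (q powi e)) powi i = (- 1) powi i * q powi (e * i)"
      using power_int_mult_distrib[of "- 1" "q powi e" i] by (simp add: power_int_mult)
    moreover have "(- 1 :: complex) powi i * (- 1) powi i = 1"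
      by (simp flip: power_int_mult_distrib)
    ultimately show ?thesis
      using q0 by (simp add: jacobi_term_def power_int_add power_int_mult)
  qed
  then have "jacobi_term (- (q powi e)) (q powi d) = (\<lambda>i. q powi (d * tri i + e * i))"
    by (rule ext)
  with jacobi_triple_product[OF norm_power_int_less_1[OF q d], of "- (q powi e)"] show ?thesis
    using q0 by simp
qed

text \<open>
  The quintuple product is \<open>\<Sum>u. \<epsilon> u * q powi (tri u / 3) * z powi u\<close>, where \<open>\<epsilon> u\<close> is
  \<open>1\<close>, \<open>-1\<close>, \<open>0\<close> for \<open>u mod 3 = 0, 1, 2\<close>; the division by \<open>3\<close> below is exact only if
  \<open>u mod 3 \<noteq> 2\<close>.
\<close>

definition quintuple_exponent :: "int \<Rightarrow> int \<Rightarrow> int \<Rightarrow> int" where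
  "quintuple_exponent p r u = p * (tri u div 3) + r * u"

definition quintuple_sum :: "complex \<Rightarrow> int \<Rightarrow> int \<Rightarrow> int \<Rightarrow> complex" where
  "quintuple_sum q p r u = (\<Sum>\<^sub>\<infinity>i. q powi quintuple_exponent p r (3 * i + u))"

text \<open>Multiplication by 6 removes both divisions hidden in the exponent, so that exponents can
  be compared as integer polynomials.\<close>

lemma six_quintuple_exponent:
  assumes "u mod 3 \<noteq> 2"
  shows "6 * quintuple_exponent p r u = p * (u * (u - 1)) + 6 * r * u"
proof -
  have "u mod 3 = 0 \<or> u mod 3 = 1" using assms by presburger
  then have "3 dvd u \<or> 3 dvd u - 1" by presburger
  then have "3 dvd 2 * tri u" unfolding two_tri by auto
  then have "3 dvd tri u" by presburger
  then have "6 * (tri u div 3) = u * (u - 1)"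
    using two_tri[of u] by auto
  moreover have "6 * quintuple_exponent p r u = p * (6 * (tri u div 3)) + 6 * r * u"
    by (simp add: quintuple_exponent_def)
  ultimately show ?thesis by simp
qed

text \<open>Lets a residue class be entered through any representative; the dissection uses shifted
  ones that depend on \<open>s\<close>.\<close>

lemma quintuple_sum_cong:
  assumes "[u = v] (mod 3)"
  shows "quintuple_sum q p r u = quintuple_sum q p r v"
proof -
  obtain t where t: "u = v + 3 * t"
    using assms cong_iff_lin[of v u 3] by (auto simp: cong_sym_eq)
  show ?thesis
    unfolding quintuple_sum_def
    by (rule infsum_reindex_bij_witness[of _ "\<lambda>i. i - t" "\<lambda>i. i + t"]) (auto simp: t algebra_simps)
qed

text \<open>The classes 0 and 1 are the two theta terms of \<open>quintuple_product\<close> at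
  \<open>q powi r\<close> with base \<open>q powi p\<close>, the second without its sign.\<close>

lemma quintuple_sum_0_1:
  assumes q: "0 < norm q" "norm q < 1" and p: "0 < p"
  shows "((\<lambda>i. q powi quintuple_exponent p r (3 * i)) has_sum
      theta (- ((q powi r) ^ 3 * q powi p)) ((q powi p) ^ 3)) UNIV" (is ?A)
    and "((\<lambda>i. q powi quintuple_exponent p r (3 * i + 1)) has_sum
      q powi r * theta (- ((q powi r) ^ 3 * (q powi p)\<^sup>2)) ((q powi p) ^ 3)) UNIV" (is ?B)
proof -
  have q0: "q \<noteq> 0" using q by auto
  have base: "(q powi p) ^ 3 = q powi (3 * p)"
    by (simp add: power_int_power' mult.commute)
  have 0: "(q powi r) ^ 3 * q powi p = q powi (3 * r + p)"
    and 1: "(q powi r) ^ 3 * (q powi p)\<^sup>2 = q powi (3 * r + 2 * p)"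
    using q0 by (simp_all add: power_int_power' power_int_add mult.commute)
  have "quintuple_exponent p r (3 * i) = 3 * p * tri i + (3 * r + p) * i" for i
  proof -
    have "6 * quintuple_exponent p r (3 * i) = 9 * p * (i * (i - 1)) + 6 * ((3 * r + p) * i)"
      by (subst six_quintuple_exponent) (simp_all add: algebra_simps)
    also have "\<dots> = 6 * (3 * p * tri i + (3 * r + p) * i)"
      unfolding two_tri[symmetric] by simp
    finally show ?thesis by simp
  qed
  with has_sum_theta_minus_powi[OF q, of "3 * p" "3 * r + p"] p show ?A
    by (simp add: base 0)
  have "quintuple_exponent p r (3 * i + 1) = r + (3 * p * tri i + (3 * r + 2 * p) * i)" for i
  proof -
    have "6 * quintuple_exponent p r (3 * i + 1) =
        6 * r + 9 * p * (i * (i - 1)) + 6 * ((3 * r + 2 * p) * i)"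
      by (subst six_quintuple_exponent) (simp_all add: algebra_simps)
    also have "\<dots> = 6 * (r + (3 * p * tri i + (3 * r + 2 * p) * i))"
      unfolding two_tri[symmetric] by simp
    finally show ?thesis by simp
  qed
  then have "q powi quintuple_exponent p r (3 * i + 1) =
      q powi r * q powi (3 * p * tri i + (3 * r + 2 * p) * i)" for i
    using power_int_add[of q r] q0 by simp
  then show ?B
    using has_sum_cmult_right[OF has_sum_theta_minus_powi[OF q, of "3 * p" "3 * r + 2 * p"], of "q powi r"] p
    by (simp add: base 1)
qed

lemma has_sum_quintuple_sum:
  assumes q: "0 < norm q" "norm q < 1" and p: "0 < p" and u: "u mod 3 \<noteq> 2"
  shows "((\<lambda>i. q powi quintuple_exponent p r (3 * i + u)) has_sum quintuple_sum q p r u) UNIV"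
proof -
  have summable: "(\<lambda>i. q powi quintuple_exponent p r (3 * i + u mod 3)) summable_on UNIV"
  proof (cases "u mod 3 = 0")
    case True
    then show ?thesis using quintuple_sum_0_1(1)[OF q p] by (auto dest: has_sum_imp_summable)
  next
    case False
    with u have "u mod 3 = 1" by presburger
    then show ?thesis using quintuple_sum_0_1(2)[OF q p] by (auto dest: has_sum_imp_summable)
  qed
  have "(\<lambda>i. q powi quintuple_exponent p r (3 * i + u)) summable_on UNIV"
  proof (subst summable_on_reindex_bij_witness[of _ "\<lambda>i. i - u div 3" "\<lambda>i. i + u div 3"])
    show "q powi quintuple_exponent p r (3 * (i + u div 3) + u mod 3) =
        q powi quintuple_exponent p r (3 * i + u)" for i
      using mult_div_mod_eq[of 3 u] by (simp add: algebra_simps)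
  qed (use summable in auto)
  then show ?thesis
    unfolding quintuple_sum_def by (rule has_sum_infsum)
qed

lemma quintuple_eq_quintuple_sum:
  assumes "0 < norm q" "norm q < 1" "0 < p"
  shows "quintuple (q powi r) (q powi p) = quintuple_sum q p r 0 - quintuple_sum q p r 1"
  using quintuple_product[OF norm_power_int_less_1[OF assms], of "q powi r"]
    infsumI[OF quintuple_sum_0_1(1)[OF assms, of r]] infsumI[OF quintuple_sum_0_1(2)[OF assms, of r]]
    assms(1)
  by (auto simp: quintuple_sum_def)

section \<open>The sublattice of a Gaussian integer of norm p and its cosets\<close>

lemma gaussian_residue_bij:
  fixes p m n M :: int
  assumes p: "0 < p" and pmn: "p = m\<^sup>2 + n\<^sup>2" and M: "[m * M = 1] (mod p)"
  shows "bij_betw (\<lambda>(k, i, j). (m * i + n * j + k, n * i - m * j)) ({0..p - 1} \<times> UNIV) UNIV"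
  unfolding bij_betw_def
proof
  have cop: "coprime m p"
    using M coprime_iff_invertible_int by auto
  show "inj_on (\<lambda>(k, i, j). (m * i + n * j + k, n * i - m * j)) ({0..p - 1} \<times> UNIV)"
  proof (rule inj_onI)
    fix x x' :: "int \<times> int \<times> int"
    obtain k i j k' i' j' where x: "x = (k, i, j)" "x' = (k', i', j')"
      by (cases x; cases x') auto
    assume "x \<in> {0..p - 1} \<times> UNIV" "x' \<in> {0..p - 1} \<times> UNIV"
      and "(case x of (k, i, j) \<Rightarrow> (m * i + n * j + k, n * i - m * j)) =
        (case x' of (k, i, j) \<Rightarrow> (m * i + n * j + k, n * i - m * j))"
    then have k: "k \<in> {0..p - 1}" "k' \<in> {0..p - 1}"
      and 1: "m * i + n * j + k = m * i' + n * j' + k'" and 2: "n * i - m * j = n * i' - m * j'"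
      by (auto simp: x)
    \<comment> \<open>Because \<open>m\<^sup>2 + n\<^sup>2 = p\<close>, eliminating one difference
      yields \<open>p\<close> times the other; hence \<open>p\<close> divides
      \<open>m * (k' - k)\<close>, and two representatives below \<open>p\<close> must
      agree.\<close>
    have k': "k' - k = m * (i - i') + n * (j - j')" and n: "n * (i - i') = m * (j - j')"
      using 1 2 by (simp_all add: algebra_simps)
    have "m * (k' - k) = m * m * (i - i') + n * (m * (j - j'))"
      unfolding k' by (simp add: algebra_simps)
    then have 4: "m * (k' - k) = p * (i - i')"
      unfolding n[symmetric] pmn by (simp add: algebra_simps power2_eq_square)
    have "n * (k' - k) = m * (n * (i - i')) + n * n * (j - j')"
      unfolding k' by (simp add: algebra_simps)
    then have 3: "n * (k' - k) = p * (j - j')"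
      unfolding n pmn by (simp add: algebra_simps power2_eq_square)
    from 4 have "p dvd m * (k' - k)" by simp
    then have "p dvd k' - k"
      using cop by (simp add: coprime_commute coprime_dvd_mult_right_iff)
    then have "k' = k"
      using k zdvd_not_zless[of "k' - k" p] zdvd_not_zless[of "k - k'" p] dvd_diff_commute[of p k k']
      by (cases k k' rule: linorder_cases) auto
    with 3 4 p show "x = x'"
      by (simp add: x)
  qed
  have "(x, y) \<in> (\<lambda>(k, i, j). (m * i + n * j + k, n * i - m * j)) ` ({0..p - 1} \<times> UNIV)" for x y
  proof -
    \<comment> \<open>The remainder is forced: \<open>m * (x - k) + n * y\<close> must be divisible
      by \<open>p\<close>, and \<open>M\<close> inverts \<open>m\<close>.\<close>
    define k where "k = (x + M * n * y) mod p"
    have k: "[x - k = - (M * n * y)] (mod p)"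
      using cong_diff[OF cong_refl[of x p], of k "x + M * n * y"] by (simp add: k_def)
    have "[m * (x - k) + n * y = m * - (M * n * y) + n * y] (mod p)"
      by (intro cong_add cong_mult k cong_refl)
    also have "m * - (M * n * y) + n * y = n * y * (1 - m * M)" by (simp add: algebra_simps)
    also have "[\<dots> = n * y * (1 - 1)] (mod p)"
      by (intro cong_mult cong_diff cong_refl M)
    finally have "p dvd m * (x - k) + n * y" by (simp add: cong_0_iff)
    then obtain i where i: "m * (x - k) + n * y = p * i" by blast
    \<comment> \<open>Divisibility for the second coordinate follows from the first, since
      \<open>m\<close> can be cancelled modulo \<open>p\<close>.\<close>
    have "m * (n * (x - k) - m * y) = n * (m * (x - k) + n * y) - p * y"
      unfolding pmn by (simp add: algebra_simps power2_eq_square)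
    then have "m * (n * (x - k) - m * y) = p * (n * i - y)"
      unfolding i by (simp add: algebra_simps)
    then have "p dvd m * (n * (x - k) - m * y)" by simp
    then have "p dvd n * (x - k) - m * y"
      using cop by (simp add: coprime_commute coprime_dvd_mult_right_iff)
    then obtain j where j: "n * (x - k) - m * y = p * j" by blast
    have "p * x = m * (m * (x - k) + n * y) + n * (n * (x - k) - m * y) + p * k"
      and "p * y = n * (m * (x - k) + n * y) - m * (n * (x - k) - m * y)"
      unfolding pmn by (simp_all add: algebra_simps power2_eq_square)
    then have "p * x = p * (m * i + n * j + k)" "p * y = p * (n * i - m * j)"
      unfolding i j by (simp_all add: algebra_simps)
    then have "(x, y) = (m * i + n * j + k, n * i - m * j)"
      using p by simp
    moreover have "k \<in> {0..p - 1}"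
      using p by (simp add: k_def)
    ultimately show ?thesis by (intro image_eqI[of _ _ "(k, i, j)"]) auto
  qed
  then show "(\<lambda>(k, i, j). (m * i + n * j + k, n * i - m * j)) ` ({0..p - 1} \<times> UNIV) = UNIV"
    by auto
qed

text \<open>After the change of variables the quadratic form has no mixed term, so on the coset of
  \<open>k\<close> the double series splits into two thetas. \<open>e k\<close> is the exponent at
  \<open>i = j = 0\<close>; \<open>A k\<close> and \<open>B k\<close> are the linear coefficients in
  \<open>i\<close> and \<open>j\<close> beside \<open>3 * p\<^sup>2 * tri\<close>.\<close>

lemma quintuple_sum_product:
  fixes p m n M b u v :: int and A B e :: "int \<Rightarrow> int"
  assumes q: "0 < norm q" "norm q < 1" and p: "0 < p" and pmn: "p = m\<^sup>2 + n\<^sup>2"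
    and M: "[m * M = 1] (mod p)"
    and uv: "u mod 3 \<noteq> 2" "v mod 3 \<noteq> 2"
    and A: "\<And>k. 2 * A k = 3 * p\<^sup>2 + 2 * p * (m * (3 * k + u) + n * v) - p * (m + n) + 6 * b * p"
    and B: "\<And>k. 2 * B k = 3 * p\<^sup>2 + 2 * p * (n * (3 * k + u) - m * v) - p * (n - m)"
    and e: "\<And>k. 6 * e k = p * ((3 * k + u) * (3 * k + u - 1) + v * (v - 1)) + 6 * b * (m * (3 * k + u) + n * v)"
  shows "quintuple_sum q p (b * m) u * quintuple_sum q p (b * n) v =
    (\<Sum>k = 0..p - 1. q powi e k * (theta (- (q powi A k)) (q powi (3 * p\<^sup>2)) *
      theta (- (q powi B k)) (q powi (3 * p\<^sup>2))))"
proof -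
  have q0: "q \<noteq> 0" using q by auto
  define S where "S = quintuple_sum q p (b * m) u * quintuple_sum q p (b * n) v"
  define \<Phi> where "\<Phi> = (\<lambda>(x, y). q powi quintuple_exponent p (b * m) (3 * x + u) *
      q powi quintuple_exponent p (b * n) (3 * y + v))"
  have "(\<Phi> has_sum S) (UNIV \<times> UNIV)"
    unfolding \<Phi>_def S_def by (intro has_sum_product has_sum_quintuple_sum q p uv)
  then have "((\<lambda>x. \<Phi> ((\<lambda>(k, i, j). (m * i + n * j + k, n * i - m * j)) x)) has_sum S) ({0..p - 1} \<times> UNIV)"
    using has_sum_reindex_bij_betw[OF gaussian_residue_bij[OF p pmn M], of \<Phi> S] by simp
  moreover have "\<Phi> (m * i + n * j + k, n * i - m * j) = q powi e k *
      (q powi (3 * p\<^sup>2 * tri i + A k * i) * q powi (3 * p\<^sup>2 * tri j + B k * j))" for k i j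
  proof -
    define x y where "x = 3 * (m * i + n * j + k) + u" and "y = 3 * (n * i - m * j) + v"
    have x3: "x mod 3 \<noteq> 2" and y3: "y mod 3 \<noteq> 2"
      using uv by (simp_all only: x_def y_def mod_mult_self4 not_False_eq_True)
    have A': "A k * 2 = 3 * p\<^sup>2 + 2 * p * (m * (3 * k + u) + n * v) - p * (m + n) + 6 * b * p"
      and B': "B k * 2 = 3 * p\<^sup>2 + 2 * p * (n * (3 * k + u) - m * v) - p * (n - m)"
      using A[of k] B[of k] by simp_all
    have "6 * (quintuple_exponent p (b * m) x + quintuple_exponent p (b * n) y) =
        p * (x * x + y * y - x - y) + 6 * b * (m * x + n * y)"
      using six_quintuple_exponent[OF x3, of p "b * m"] six_quintuple_exponent[OF y3, of p "b * n"]
      by (simp add: algebra_simps)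
    \<comment> \<open>The terms in \<open>i * j\<close> cancel here, and \<open>j\<close> cancels
      from \<open>m * x + n * y\<close> below, so \<open>b\<close> enters \<open>A\<close> but not
      \<open>B\<close>.\<close>
    also have "x * x + y * y = 9 * p * (i * i + j * j) + 6 * i * (m * (3 * k + u) + n * v)
        + 6 * j * (n * (3 * k + u) - m * v) + (3 * k + u) * (3 * k + u) + v * v"
      unfolding x_def y_def pmn by (simp add: algebra_simps power2_eq_square)
    also have "m * x + n * y = 3 * p * i + m * (3 * k + u) + n * v"
      unfolding x_def y_def pmn by (simp add: algebra_simps power2_eq_square)
    also have "p * (9 * p * (i * i + j * j) + 6 * i * (m * (3 * k + u) + n * v)
        + 6 * j * (n * (3 * k + u) - m * v) + (3 * k + u) * (3 * k + u) + v * v - x - y) +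
        6 * b * (3 * p * i + m * (3 * k + u) + n * v) =
        6 * e k + 9 * p\<^sup>2 * (i * (i - 1) + j * (j - 1)) + 3 * (A k * 2) * i + 3 * (B k * 2) * j"
      unfolding e A' B' x_def y_def by (simp add: algebra_simps power2_eq_square)
    also have "\<dots> = 6 * (e k + ((3 * p\<^sup>2 * tri i + A k * i) + (3 * p\<^sup>2 * tri j + B k * j)))"
      unfolding two_tri[symmetric] by (simp add: algebra_simps)
    finally have "quintuple_exponent p (b * m) x + quintuple_exponent p (b * n) y =
        e k + ((3 * p\<^sup>2 * tri i + A k * i) + (3 * p\<^sup>2 * tri j + B k * j))"
      by simp
    then have "q powi quintuple_exponent p (b * m) x * q powi quintuple_exponent p (b * n) y =
        q powi e k * (q powi (3 * p\<^sup>2 * tri i + A k * i) * q powi (3 * p\<^sup>2 * tri j + B k * j))"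
      using q0 by (simp only: power_int_add[symmetric] simp_thms)
    then show ?thesis
      unfolding \<Phi>_def x_def y_def by simp
  qed
  ultimately have "((\<lambda>(k, i, j). q powi e k *
      (q powi (3 * p\<^sup>2 * tri i + A k * i) * q powi (3 * p\<^sup>2 * tri j + B k * j))) has_sum S) ({0..p - 1} \<times> UNIV)"
    by (simp add: case_prod_unfold)
  then have "((\<lambda>k. q powi e k * (theta (- (q powi A k)) (q powi (3 * p\<^sup>2)) *
      theta (- (q powi B k)) (q powi (3 * p\<^sup>2)))) has_sum S) {0..p - 1}"
  proof (rule has_sum_SigmaD)
    fix k
    have d: "0 < 3 * p\<^sup>2" using p by simp
    have "((\<lambda>(i, j). q powi (3 * p\<^sup>2 * tri i + A k * i) * q powi (3 * p\<^sup>2 * tri j + B k * j)) has_sum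
        theta (- (q powi A k)) (q powi (3 * p\<^sup>2)) * theta (- (q powi B k)) (q powi (3 * p\<^sup>2))) (UNIV \<times> UNIV)"
      by (intro has_sum_product has_sum_theta_minus_powi q d)
    from has_sum_cmult_right[OF this, of "q powi e k"]
    show "((\<lambda>y. case (k, y) of (k, i, j) \<Rightarrow> q powi e k *
        (q powi (3 * p\<^sup>2 * tri i + A k * i) * q powi (3 * p\<^sup>2 * tri j + B k * j))) has_sum
        q powi e k * (theta (- (q powi A k)) (q powi (3 * p\<^sup>2)) *
          theta (- (q powi B k)) (q powi (3 * p\<^sup>2)))) UNIV"
      by (simp add: case_prod_unfold)
  qed
  then show ?thesis
    unfolding S_def[symmetric]
    by (rule has_sum_unique) (rule has_sum_finite, rule finite_atLeastAtMost_int)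
qed

section \<open>Matching Winquist's identity with the coset sums\<close>

lemma winquist_powi:
  assumes q: "0 < norm q" "norm q < 1" and d: "0 < d"
  defines "\<Theta> \<equiv> \<lambda>x. theta (- (q powi x)) (q powi (3 * d))"
  shows "q powi e * W (- (q powi x)) (- (q powi y)) (q powi d) =
    q powi e * (\<Theta> (3 * x) * \<Theta> (3 * y + d)) + q powi (e + y) * (\<Theta> (3 * x) * \<Theta> (3 * y + 2 * d))
    - q powi (e + x - y) * (\<Theta> (3 * x + d) * \<Theta> (3 * y))
    - q powi (e + 2 * x - y) * (\<Theta> (3 * x + 2 * d) * \<Theta> (3 * y))"
proof -
  have q0: "q \<noteq> 0" using q by auto
  have base: "(q powi d) ^ 3 = q powi (3 * d)"
    by (simp add: power_int_power' mult.commute)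
  have c: "(- (q powi t)) ^ 3 = - (q powi (3 * t))" for t
    by (simp add: power_int_power' mult.commute power_minus_odd)
  have c1: "- (q powi (3 * t)) * q powi d = - (q powi (3 * t + d))"
    and c2: "- (q powi (3 * t)) * (q powi d)\<^sup>2 = - (q powi (3 * t + 2 * d))" for t
    using q0 by (simp_all add: power_int_power' power_int_add mult.commute)
  \<comment> \<open>The minus sign of the argument survives cubing and turns the difference in
    \<open>winquist_factor\<close> into a sum, so \<open>W\<close> has two products with plus and
    two with minus.\<close>
  have wf: "winquist_factor (q powi d) (- (q powi t)) = \<Theta> (3 * t + d) + q powi t * \<Theta> (3 * t + 2 * d)" for t
    unfolding winquist_factor_def c c1 c2 base \<Theta>_def by simp
  have W: "W (- (q powi x)) (- (q powi y)) (q powi d) =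
      \<Theta> (3 * x) * (\<Theta> (3 * y + d) + q powi y * \<Theta> (3 * y + 2 * d))
      - q powi x / q powi y * \<Theta> (3 * y) * (\<Theta> (3 * x + d) + q powi x * \<Theta> (3 * x + 2 * d))"
    using winquist[OF norm_power_int_less_1[OF q d], of "- (q powi x)" "- (q powi y)"] q0
    by (simp add: wf c base \<Theta>_def)
  have e1: "q powi (e + y) = q powi e * q powi y"
    and e2: "q powi (e + x - y) = q powi e * (q powi x / q powi y)"
    using q0 by (simp_all add: power_int_add power_int_diff)
  have "q powi (e + 2 * x - y) = q powi ((e + x - y) + x)"
    by (simp add: algebra_simps)
  also have "\<dots> = q powi e * (q powi x / q powi y) * q powi x"
    using q0 by (subst power_int_add) (simp_all add: e2)
  finally have e3: "q powi (e + 2 * x - y) = q powi e * (q powi x / q powi y) * q powi x" .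
  show ?thesis
    unfolding W e1 e2 e3
    by (simp only: distrib_left right_diff_distrib mult_ac diff_diff_eq)
qed

text \<open>Expansion of two differences: equal residues come with plus, different ones with minus.
  \<open>r\<close> and \<open>t\<close> leave open which product of each pair is listed
  first.\<close>

lemma quintuple_product_eq_quintuple_sums:
  fixes p m n b r t :: int
  assumes q: "0 < norm q" "norm q < 1" and p: "0 < p"
    and r: "r \<in> {0, 1}" and t: "t \<in> {0, 1}"
    and uv: "[u1 = r] (mod 3)" "[v1 = r] (mod 3)" "[u2 = 1 - r] (mod 3)" "[v2 = 1 - r] (mod 3)"
      "[u3 = t] (mod 3)" "[v3 = 1 - t] (mod 3)" "[u4 = 1 - t] (mod 3)" "[v4 = t] (mod 3)"
  shows "quintuple (q powi (b * m)) (q powi p) * quintuple (q powi (b * n)) (q powi p) =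
    quintuple_sum q p (b * m) u1 * quintuple_sum q p (b * n) v1
    + quintuple_sum q p (b * m) u2 * quintuple_sum q p (b * n) v2
    - quintuple_sum q p (b * m) u3 * quintuple_sum q p (b * n) v3
    - quintuple_sum q p (b * m) u4 * quintuple_sum q p (b * n) v4"
  unfolding quintuple_eq_quintuple_sum[OF q p] uv[THEN quintuple_sum_cong]
  using r t by (auto simp: algebra_simps)

text \<open>\<open>r\<close> records the class of \<open>m\<close> modulo 3 when \<open>m\<close>
  and \<open>n\<close> are opposite there, and \<open>a\<close>, \<open>c\<close>, \<open>e\<close>
  are the exponents with denominators cleared. Each product in \<open>winquist_powi\<close>, summed
  over the cosets, is one pair of residue classes.\<close>

lemma quintuple_product_dissection:
  fixes p m n M b s r :: int and a c e :: "int \<Rightarrow> int"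
  assumes q: "0 < norm q" "norm q < 1" and p: "0 < p" and pmn: "p = m\<^sup>2 + n\<^sup>2"
    and M: "[m * M = 1] (mod p)"
    and r: "r \<in> {0, 1}" and m: "[m = 2 * r - 1] (mod 3)" and n: "[n = 1 - 2 * r] (mod 3)"
    and s: "[s = 1] (mod 3)"
    and a: "\<And>k. 6 * a k = 6 * b * p + 6 * k * m * p - (m + n) * p + 3 * p\<^sup>2"
    and c: "\<And>k. 6 * c k = 6 * k * n * p + (m - n) * p + 3 * p\<^sup>2 - 2 * n * s * p\<^sup>2"
    and e: "\<And>k. 6 * e k = 18 * b * k * m + 3 * k * (3 * k - 1) * p
      + p * (1 - n * s) * (6 * k * n + (p + m - n * (1 + p * s)))"
  shows "quintuple (q powi (b * m)) (q powi p) * quintuple (q powi (b * n)) (q powi p) =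
    (\<Sum>k = 0..p - 1. q powi e k * W (- (q powi a k)) (- (q powi c k)) (q powi p\<^sup>2))"
proof -
  define \<Theta> where "\<Theta> = (\<lambda>x. theta (- (q powi x)) (q powi (3 * p\<^sup>2)))"
  \<comment> \<open>The shifts are found by comparing the coefficients of \<open>i\<close> and \<open>j\<close>, which determines
    \<open>m * u + n * v\<close> and \<open>n * u - m * v\<close>.\<close>
  define u1 v1 where "u1 = n - n\<^sup>2 * s" and "v1 = m * n * s - m"
  define u2 v2 where "u2 = 2 * n - n\<^sup>2 * s" and "v2 = m * n * s - 2 * m"
  define u3 v3 where "u3 = m - n\<^sup>2 * s" and "v3 = n + m * n * s"
  define u4 v4 where "u4 = 2 * m - n\<^sup>2 * s" and "v4 = 2 * n + m * n * s"
  \<comment> \<open>Substituting the residues of \<open>m\<close>, \<open>n\<close> and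
    \<open>s\<close> shows that, for either \<open>r\<close>, the four pairs run through all
    combinations of 0 and 1.\<close>
  have res: "[u1 = (1 - 2 * r) - (1 - 2 * r)\<^sup>2 * 1] (mod 3)" "[v1 = (2 * r - 1) * (1 - 2 * r) * 1 - (2 * r - 1)] (mod 3)"
    "[u2 = 2 * (1 - 2 * r) - (1 - 2 * r)\<^sup>2 * 1] (mod 3)" "[v2 = (2 * r - 1) * (1 - 2 * r) * 1 - 2 * (2 * r - 1)] (mod 3)"
    "[u3 = (2 * r - 1) - (1 - 2 * r)\<^sup>2 * 1] (mod 3)" "[v3 = (1 - 2 * r) + (2 * r - 1) * (1 - 2 * r) * 1] (mod 3)"
    "[u4 = 2 * (2 * r - 1) - (1 - 2 * r)\<^sup>2 * 1] (mod 3)" "[v4 = 2 * (1 - 2 * r) + (2 * r - 1) * (1 - 2 * r) * 1] (mod 3)"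
    unfolding u1_def v1_def u2_def v2_def u3_def v3_def u4_def v4_def
    by (rule m n s cong_refl cong_add cong_diff cong_mult cong_pow cong_minus_minus_iff[THEN iffD2])+
  have uv: "[u1 = r] (mod 3)" "[v1 = r] (mod 3)"
    "[u2 = 1 - r] (mod 3)" "[v2 = 1 - r] (mod 3)"
    "[u3 = 1 - r] (mod 3)" "[v3 = r] (mod 3)"
    "[u4 = r] (mod 3)" "[v4 = 1 - r] (mod 3)"
    by (rule res[THEN cong_trans], use r in \<open>fastforce simp: cong_def\<close>)+
  have mod3: "x mod 3 \<noteq> 2" if "[x = y] (mod 3)" "y \<in> {r, 1 - r}" for x y
    using r that by (auto simp: cong_def)
  \<comment> \<open>Here \<open>m * u1 + n * v1 = 0\<close> and
    \<open>n * u1 - m * v1 = p * (1 - n * s)\<close>, as the two theta arguments demand.\<close>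
  have T1: "quintuple_sum q p (b * m) u1 * quintuple_sum q p (b * n) v1 =
      (\<Sum>k = 0..p - 1. q powi e k * (\<Theta> (3 * a k) * \<Theta> (3 * c k + p\<^sup>2)))"
    unfolding \<Theta>_def
  proof (rule quintuple_sum_product[OF q p pmn M mod3[OF uv(1)] mod3[OF uv(2)]])
    fix k
    show "2 * (3 * a k) = 3 * p\<^sup>2 + 2 * p * (m * (3 * k + u1) + n * v1) - p * (m + n) + 6 * b * p"
      and "2 * (3 * c k + p\<^sup>2) = 3 * p\<^sup>2 + 2 * p * (n * (3 * k + u1) - m * v1) - p * (n - m)"
      and "6 * e k = p * ((3 * k + u1) * (3 * k + u1 - 1) + v1 * (v1 - 1))
        + 6 * b * (m * (3 * k + u1) + n * v1)"
      using a[of k] c[of k] e[of k] unfolding pmn u1_def v1_def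
      by (simp_all add: algebra_simps power2_eq_square)
  qed simp_all
  have T2: "quintuple_sum q p (b * m) u2 * quintuple_sum q p (b * n) v2 =
      (\<Sum>k = 0..p - 1. q powi (e k + c k) * (\<Theta> (3 * a k) * \<Theta> (3 * c k + 2 * p\<^sup>2)))"
    unfolding \<Theta>_def
  proof (rule quintuple_sum_product[OF q p pmn M mod3[OF uv(3)] mod3[OF uv(4)]])
    fix k
    show "2 * (3 * a k) = 3 * p\<^sup>2 + 2 * p * (m * (3 * k + u2) + n * v2) - p * (m + n) + 6 * b * p"
      and "2 * (3 * c k + 2 * p\<^sup>2) = 3 * p\<^sup>2 + 2 * p * (n * (3 * k + u2) - m * v2) - p * (n - m)"
      and "6 * (e k + c k) = p * ((3 * k + u2) * (3 * k + u2 - 1) + v2 * (v2 - 1))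
        + 6 * b * (m * (3 * k + u2) + n * v2)"
      using a[of k] c[of k] e[of k] unfolding pmn u2_def v2_def
      by (simp_all add: algebra_simps power2_eq_square)
  qed simp_all
  have T3: "quintuple_sum q p (b * m) u3 * quintuple_sum q p (b * n) v3 =
      (\<Sum>k = 0..p - 1. q powi (e k + a k - c k) * (\<Theta> (3 * a k + p\<^sup>2) * \<Theta> (3 * c k)))"
    unfolding \<Theta>_def
  proof (rule quintuple_sum_product[OF q p pmn M mod3[OF uv(5)] mod3[OF uv(6)]])
    fix k
    show "2 * (3 * a k + p\<^sup>2) = 3 * p\<^sup>2 + 2 * p * (m * (3 * k + u3) + n * v3) - p * (m + n) + 6 * b * p"
      and "2 * (3 * c k) = 3 * p\<^sup>2 + 2 * p * (n * (3 * k + u3) - m * v3) - p * (n - m)"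
      and "6 * (e k + a k - c k) = p * ((3 * k + u3) * (3 * k + u3 - 1) + v3 * (v3 - 1))
        + 6 * b * (m * (3 * k + u3) + n * v3)"
      using a[of k] c[of k] e[of k] unfolding pmn u3_def v3_def
      by (simp_all add: algebra_simps power2_eq_square)
  qed simp_all
  have T4: "quintuple_sum q p (b * m) u4 * quintuple_sum q p (b * n) v4 =
      (\<Sum>k = 0..p - 1. q powi (e k + 2 * a k - c k) * (\<Theta> (3 * a k + 2 * p\<^sup>2) * \<Theta> (3 * c k)))"
    unfolding \<Theta>_def
  proof (rule quintuple_sum_product[OF q p pmn M mod3[OF uv(7)] mod3[OF uv(8)]])
    fix k
    show "2 * (3 * a k + 2 * p\<^sup>2) = 3 * p\<^sup>2 + 2 * p * (m * (3 * k + u4) + n * v4) - p * (m + n) + 6 * b * p"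
      and "2 * (3 * c k) = 3 * p\<^sup>2 + 2 * p * (n * (3 * k + u4) - m * v4) - p * (n - m)"
      and "6 * (e k + 2 * a k - c k) = p * ((3 * k + u4) * (3 * k + u4 - 1) + v4 * (v4 - 1))
        + 6 * b * (m * (3 * k + u4) + n * v4)"
      using a[of k] c[of k] e[of k] unfolding pmn u4_def v4_def
      by (simp_all add: algebra_simps power2_eq_square)
  qed simp_all
  have W: "q powi e k * W (- (q powi a k)) (- (q powi c k)) (q powi p\<^sup>2) =
      q powi e k * (\<Theta> (3 * a k) * \<Theta> (3 * c k + p\<^sup>2))
      + q powi (e k + c k) * (\<Theta> (3 * a k) * \<Theta> (3 * c k + 2 * p\<^sup>2))
      - q powi (e k + a k - c k) * (\<Theta> (3 * a k + p\<^sup>2) * \<Theta> (3 * c k))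
      - q powi (e k + 2 * a k - c k) * (\<Theta> (3 * a k + 2 * p\<^sup>2) * \<Theta> (3 * c k))" for k
    using winquist_powi[OF q, of "p\<^sup>2" "e k" "a k" "c k"] p by (simp add: \<Theta>_def)
  show ?thesis
    unfolding W sum_subtractf sum.distrib T1[symmetric] T2[symmetric] T3[symmetric] T4[symmetric]
    by (rule quintuple_product_eq_quintuple_sums[OF q p r _ uv(1-4) ]) (use r uv(5-8) in auto)
qed

text \<open>The companion for \<open>m\<close> and \<open>n\<close> equal modulo 3. Now
  \<open>c\<close> belongs to the first lattice direction and \<open>a\<close> to the second, so the
  two thetas of each product appear in exchanged order.\<close>

lemma quintuple_product_dissection_star:
  fixes p m n M b s r :: int and a c e :: "int \<Rightarrow> int"
  assumes q: "0 < norm q" "norm q < 1" and p: "0 < p" and pmn: "p = m\<^sup>2 + n\<^sup>2"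
    and M: "[m * M = 1] (mod p)"
    and r: "r \<in> {0, 1}" and m: "[m = 1 - 2 * r] (mod 3)" and n: "[n = 1 - 2 * r] (mod 3)"
    and s: "[s = 1] (mod 3)"
    and a: "\<And>k. 6 * a k = 6 * k * n * p + (m - n) * p + 3 * p\<^sup>2"
    and c: "\<And>k. 6 * c k = 6 * b * p + 6 * k * m * p - (m + n) * p + 3 * p\<^sup>2 - 2 * m * s * p\<^sup>2"
    and e: "\<And>k. 6 * e k = 18 * b * k * m + 3 * k * (3 * k - 1) * p
      + p * (1 - m * s) * (6 * (b + k * m) + (p - m * (1 + p * s) - n))"
  shows "quintuple (q powi (b * m)) (q powi p) * quintuple (q powi (b * n)) (q powi p) =
    (\<Sum>k = 0..p - 1. q powi e k * W (- (q powi a k)) (- (q powi c k)) (q powi p\<^sup>2))"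
proof -
  define \<Theta> where "\<Theta> = (\<lambda>x. theta (- (q powi x)) (q powi (3 * p\<^sup>2)))"
  \<comment> \<open>Now \<open>m * u1 + n * v1 = p * (1 - m * s)\<close> and
    \<open>n * u1 - m * v1 = 0\<close>: the term with \<open>s\<close> moves to the first
    direction.\<close>
  define u1 v1 where "u1 = m - m\<^sup>2 * s" and "v1 = n - m * n * s"
  define u2 v2 where "u2 = 2 * m - m\<^sup>2 * s" and "v2 = 2 * n - m * n * s"
  define u3 v3 where "u3 = n - m\<^sup>2 * s" and "v3 = - m - m * n * s"
  define u4 v4 where "u4 = 2 * n - m\<^sup>2 * s" and "v4 = - 2 * m - m * n * s"
  have res: "[u1 = (1 - 2 * r) - (1 - 2 * r)\<^sup>2 * 1] (mod 3)" "[v1 = (1 - 2 * r) - (1 - 2 * r) * (1 - 2 * r) * 1] (mod 3)"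
    "[u2 = 2 * (1 - 2 * r) - (1 - 2 * r)\<^sup>2 * 1] (mod 3)" "[v2 = 2 * (1 - 2 * r) - (1 - 2 * r) * (1 - 2 * r) * 1] (mod 3)"
    "[u3 = (1 - 2 * r) - (1 - 2 * r)\<^sup>2 * 1] (mod 3)" "[v3 = - (1 - 2 * r) - (1 - 2 * r) * (1 - 2 * r) * 1] (mod 3)"
    "[u4 = 2 * (1 - 2 * r) - (1 - 2 * r)\<^sup>2 * 1] (mod 3)" "[v4 = - 2 * (1 - 2 * r) - (1 - 2 * r) * (1 - 2 * r) * 1] (mod 3)"
    unfolding u1_def v1_def u2_def v2_def u3_def v3_def u4_def v4_def
    by (rule m n s cong_refl cong_add cong_diff cong_mult cong_pow cong_minus_minus_iff[THEN iffD2])+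
  have uv: "[u1 = r] (mod 3)" "[v1 = r] (mod 3)"
    "[u2 = 1 - r] (mod 3)" "[v2 = 1 - r] (mod 3)"
    "[u3 = r] (mod 3)" "[v3 = 1 - r] (mod 3)"
    "[u4 = 1 - r] (mod 3)" "[v4 = r] (mod 3)"
    by (rule res[THEN cong_trans], use r in \<open>fastforce simp: cong_def\<close>)+
  have mod3: "x mod 3 \<noteq> 2" if "[x = y] (mod 3)" "y \<in> {r, 1 - r}" for x y
    using r that by (auto simp: cong_def)
  have T1: "quintuple_sum q p (b * m) u1 * quintuple_sum q p (b * n) v1 =
      (\<Sum>k = 0..p - 1. q powi e k * (\<Theta> (3 * c k + p\<^sup>2) * \<Theta> (3 * a k)))"
    unfolding \<Theta>_def
  proof (rule quintuple_sum_product[OF q p pmn M mod3[OF uv(1)] mod3[OF uv(2)]])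
    fix k
    show "2 * (3 * c k + p\<^sup>2) = 3 * p\<^sup>2 + 2 * p * (m * (3 * k + u1) + n * v1) - p * (m + n) + 6 * b * p"
      and "2 * (3 * a k) = 3 * p\<^sup>2 + 2 * p * (n * (3 * k + u1) - m * v1) - p * (n - m)"
      and "6 * e k = p * ((3 * k + u1) * (3 * k + u1 - 1) + v1 * (v1 - 1))
        + 6 * b * (m * (3 * k + u1) + n * v1)"
      using a[of k] c[of k] e[of k] unfolding pmn u1_def v1_def
      by (simp_all add: algebra_simps power2_eq_square)
  qed simp_all
  have T2: "quintuple_sum q p (b * m) u2 * quintuple_sum q p (b * n) v2 =
      (\<Sum>k = 0..p - 1. q powi (e k + c k) * (\<Theta> (3 * c k + 2 * p\<^sup>2) * \<Theta> (3 * a k)))"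
    unfolding \<Theta>_def
  proof (rule quintuple_sum_product[OF q p pmn M mod3[OF uv(3)] mod3[OF uv(4)]])
    fix k
    show "2 * (3 * c k + 2 * p\<^sup>2) = 3 * p\<^sup>2 + 2 * p * (m * (3 * k + u2) + n * v2) - p * (m + n) + 6 * b * p"
      and "2 * (3 * a k) = 3 * p\<^sup>2 + 2 * p * (n * (3 * k + u2) - m * v2) - p * (n - m)"
      and "6 * (e k + c k) = p * ((3 * k + u2) * (3 * k + u2 - 1) + v2 * (v2 - 1))
        + 6 * b * (m * (3 * k + u2) + n * v2)"
      using a[of k] c[of k] e[of k] unfolding pmn u2_def v2_def
      by (simp_all add: algebra_simps power2_eq_square)
  qed simp_all
  have T3: "quintuple_sum q p (b * m) u3 * quintuple_sum q p (b * n) v3 =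
      (\<Sum>k = 0..p - 1. q powi (e k + a k - c k) * (\<Theta> (3 * c k) * \<Theta> (3 * a k + p\<^sup>2)))"
    unfolding \<Theta>_def
  proof (rule quintuple_sum_product[OF q p pmn M mod3[OF uv(5)] mod3[OF uv(6)]])
    fix k
    show "2 * (3 * c k) = 3 * p\<^sup>2 + 2 * p * (m * (3 * k + u3) + n * v3) - p * (m + n) + 6 * b * p"
      and "2 * (3 * a k + p\<^sup>2) = 3 * p\<^sup>2 + 2 * p * (n * (3 * k + u3) - m * v3) - p * (n - m)"
      and "6 * (e k + a k - c k) = p * ((3 * k + u3) * (3 * k + u3 - 1) + v3 * (v3 - 1))
        + 6 * b * (m * (3 * k + u3) + n * v3)"
      using a[of k] c[of k] e[of k] unfolding pmn u3_def v3_def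
      by (simp_all add: algebra_simps power2_eq_square)
  qed simp_all
  have T4: "quintuple_sum q p (b * m) u4 * quintuple_sum q p (b * n) v4 =
      (\<Sum>k = 0..p - 1. q powi (e k + 2 * a k - c k) * (\<Theta> (3 * c k) * \<Theta> (3 * a k + 2 * p\<^sup>2)))"
    unfolding \<Theta>_def
  proof (rule quintuple_sum_product[OF q p pmn M mod3[OF uv(7)] mod3[OF uv(8)]])
    fix k
    show "2 * (3 * c k) = 3 * p\<^sup>2 + 2 * p * (m * (3 * k + u4) + n * v4) - p * (m + n) + 6 * b * p"
      and "2 * (3 * a k + 2 * p\<^sup>2) = 3 * p\<^sup>2 + 2 * p * (n * (3 * k + u4) - m * v4) - p * (n - m)"
      and "6 * (e k + 2 * a k - c k) = p * ((3 * k + u4) * (3 * k + u4 - 1) + v4 * (v4 - 1))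
        + 6 * b * (m * (3 * k + u4) + n * v4)"
      using a[of k] c[of k] e[of k] unfolding pmn u4_def v4_def
      by (simp_all add: algebra_simps power2_eq_square)
  qed simp_all
  have W: "q powi e k * W (- (q powi a k)) (- (q powi c k)) (q powi p\<^sup>2) =
      q powi e k * (\<Theta> (3 * c k + p\<^sup>2) * \<Theta> (3 * a k))
      + q powi (e k + c k) * (\<Theta> (3 * c k + 2 * p\<^sup>2) * \<Theta> (3 * a k))
      - q powi (e k + a k - c k) * (\<Theta> (3 * c k) * \<Theta> (3 * a k + p\<^sup>2))
      - q powi (e k + 2 * a k - c k) * (\<Theta> (3 * c k) * \<Theta> (3 * a k + 2 * p\<^sup>2))" for k
    using winquist_powi[OF q, of "p\<^sup>2" "e k" "a k" "c k"] p by (simp add: \<Theta>_def mult.commute)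
  show ?thesis
    unfolding W sum_subtractf sum.distrib T1[symmetric] T2[symmetric] T3[symmetric] T4[symmetric]
    by (rule quintuple_product_eq_quintuple_sums[OF q p r _ uv(1-4) ]) (use r uv(5-8) in auto)
qed

text \<open>All floors are exact by the integrality lemmas, so the exponents satisfy the equations
  with cleared denominators that the two dissections ask for.\<close>

theorem theorem4p1:
  fixes p m n b \<mu> s :: int and q :: complex
  assumes "prime p" and "[p = 5] (mod 12)" and "p = m\<^sup>2 + n\<^sup>2"
    and "b > 0"
    and "[3 * m * \<mu> = 1] (mod p)" and "s = (3 * m * \<mu> - 1) div p"
    and "0 < norm q" and "norm q < 1"
  shows "([m = - n] (mod 3) \<longrightarrow>
      quintuple (q powi (b * m)) (q powi p) * quintuple (q powi (b * n)) (q powi p) =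
        (\<Sum>k = 0..p - 1. q powi \<lfloor>chi p m n b s k\<rfloor> *
          W (- (q powi \<lfloor>alpha p m n b k / 3\<rfloor>))
            (- (q powi \<lfloor>(beta p m n k - n * s * p\<^sup>2) / 3\<rfloor>))
            (q powi (p\<^sup>2)))) \<and>
    ([m = n] (mod 3) \<longrightarrow>
      quintuple (q powi (b * m)) (q powi p) * quintuple (q powi (b * n)) (q powi p) =
        (\<Sum>k = 0..p - 1. q powi \<lfloor>chi_star p m n b s k\<rfloor> *
          W (- (q powi \<lfloor>beta p m n k / 3\<rfloor>))
            (- (q powi \<lfloor>(alpha p m n b k - m * s * p\<^sup>2) / 3\<rfloor>))
            (q powi (p\<^sup>2))))"
proof (intro conjI impI)
  have "p dvd 3 * m * \<mu> - 1"
    using assms(5) by (simp add: cong_iff_dvd_diff)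
  then have ps: "p * s = 3 * m * \<mu> - 1"
    using assms(6) by simp
  note ints = assms(2,3) ps
  have p: "0 < p"
    using assms(1) by (simp add: prime_gt_0_int)
  \<comment> \<open>\<open>3 * \<mu>\<close> is the inverse of \<open>m\<close> modulo
    \<open>p\<close> used by the coset bijection.\<close>
  have M: "[m * (3 * \<mu>) = 1] (mod p)"
    using assms(5) by (simp add: mult_ac)
  have s: "[s = 1] (mod 3)"
    using s_mod[OF ints] by (simp add: cong_def)
  show "quintuple (q powi (b * m)) (q powi p) * quintuple (q powi (b * n)) (q powi p) =
      (\<Sum>k = 0..p - 1. q powi \<lfloor>chi p m n b s k\<rfloor> *
        W (- (q powi \<lfloor>alpha p m n b k / 3\<rfloor>)) (- (q powi \<lfloor>(beta p m n k - n * s * p\<^sup>2) / 3\<rfloor>)) (q powi (p\<^sup>2)))"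
    if mn: "[m = - n] (mod 3)"
  proof -
    \<comment> \<open>\<open>m\<close> is not divisible by 3, since otherwise 3 would divide
      \<open>n\<close> and then \<open>p\<close>; so \<open>r\<close> captures the two remaining
      classes.\<close>
    define r where "r = (if m mod 3 = 2 then 0 else 1 :: int)"
    have "3 dvd m + n"
      using mn by (simp add: cong_iff_dvd_diff)
    then have r: "r \<in> {0, 1}" "[m = 2 * r - 1] (mod 3)" "[n = 1 - 2 * r] (mod 3)"
      using m_mod[OF ints] unfolding cong_def r_def by (auto split: if_splits; presburger)+
    show ?thesis
    proof (rule quintuple_product_dissection[OF assms(7,8) p assms(3) M r s])
      fix k
      have "real_of_int (6 * \<lfloor>alpha p m n b k / 3\<rfloor>) =
          real_of_int (6 * b * p + 6 * k * m * p - (m + n) * p + 3 * p\<^sup>2)"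
        using of_int_floor[OF alpha_Ints[OF ints mn, of b k]] by (simp add: alpha_def field_simps)
      then show "6 * \<lfloor>alpha p m n b k / 3\<rfloor> = 6 * b * p + 6 * k * m * p - (m + n) * p + 3 * p\<^sup>2"
        by (simp only: of_int_eq_iff)
      have "real_of_int (6 * \<lfloor>(beta p m n k - n * s * p\<^sup>2) / 3\<rfloor>) =
          real_of_int (6 * k * n * p + (m - n) * p + 3 * p\<^sup>2 - 2 * n * s * p\<^sup>2)"
        using of_int_floor[OF beta_shift_Ints[OF ints mn, of k]] by (simp add: beta_def field_simps)
      then show "6 * \<lfloor>(beta p m n k - n * s * p\<^sup>2) / 3\<rfloor> =
          6 * k * n * p + (m - n) * p + 3 * p\<^sup>2 - 2 * n * s * p\<^sup>2"
        by (simp only: of_int_eq_iff)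
      have "real_of_int (6 * \<lfloor>chi p m n b s k\<rfloor>) = real_of_int (18 * b * k * m + 3 * k * (3 * k - 1) * p
          + p * (1 - n * s) * (6 * k * n + (p + m - n * (1 + p * s))))"
        using of_int_floor[OF chi_Ints[OF ints mn, of b k]] by (simp add: chi_def gamma_def field_simps)
      then show "6 * \<lfloor>chi p m n b s k\<rfloor> = 18 * b * k * m + 3 * k * (3 * k - 1) * p
          + p * (1 - n * s) * (6 * k * n + (p + m - n * (1 + p * s)))"
        by (simp only: of_int_eq_iff)
    qed
  qed
  show "quintuple (q powi (b * m)) (q powi p) * quintuple (q powi (b * n)) (q powi p) =
      (\<Sum>k = 0..p - 1. q powi \<lfloor>chi_star p m n b s k\<rfloor> *
        W (- (q powi \<lfloor>beta p m n k / 3\<rfloor>)) (- (q powi \<lfloor>(alpha p m n b k - m * s * p\<^sup>2) / 3\<rfloor>)) (q powi (p\<^sup>2)))"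
    if mn: "[m = n] (mod 3)"
  proof -
    define r where "r = (if m mod 3 = 1 then 0 else 1 :: int)"
    have "3 dvd m - n"
      using mn by (simp add: cong_iff_dvd_diff)
    then have r: "r \<in> {0, 1}" "[m = 1 - 2 * r] (mod 3)" "[n = 1 - 2 * r] (mod 3)"
      using m_mod[OF ints] unfolding cong_def r_def by (auto split: if_splits; presburger)+
    show ?thesis
    proof (rule quintuple_product_dissection_star[OF assms(7,8) p assms(3) M r s])
      fix k
      have "real_of_int (6 * \<lfloor>beta p m n k / 3\<rfloor>) = real_of_int (6 * k * n * p + (m - n) * p + 3 * p\<^sup>2)"
        using of_int_floor[OF beta_Ints[OF ints mn, of k]] by (simp add: beta_def field_simps)
      then show "6 * \<lfloor>beta p m n k / 3\<rfloor> = 6 * k * n * p + (m - n) * p + 3 * p\<^sup>2"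
        by (simp only: of_int_eq_iff)
      have "real_of_int (6 * \<lfloor>(alpha p m n b k - m * s * p\<^sup>2) / 3\<rfloor>) =
          real_of_int (6 * b * p + 6 * k * m * p - (m + n) * p + 3 * p\<^sup>2 - 2 * m * s * p\<^sup>2)"
        using of_int_floor[OF alpha_shift_Ints[OF ints mn, of b k]] by (simp add: alpha_def field_simps)
      then show "6 * \<lfloor>(alpha p m n b k - m * s * p\<^sup>2) / 3\<rfloor> =
          6 * b * p + 6 * k * m * p - (m + n) * p + 3 * p\<^sup>2 - 2 * m * s * p\<^sup>2"
        by (simp only: of_int_eq_iff)
      have "real_of_int (6 * \<lfloor>chi_star p m n b s k\<rfloor>) = real_of_int (18 * b * k * m + 3 * k * (3 * k - 1) * p
          + p * (1 - m * s) * (6 * (b + k * m) + (p - m * (1 + p * s) - n)))"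
        using of_int_floor[OF chi_star_Ints[OF ints mn, of b k]] by (simp add: chi_star_def gamma_def field_simps)
      then show "6 * \<lfloor>chi_star p m n b s k\<rfloor> = 18 * b * k * m + 3 * k * (3 * k - 1) * p
          + p * (1 - m * s) * (6 * (b + k * m) + (p - m * (1 + p * s) - n))"
        by (simp only: of_int_eq_iff)
    qed
  qed
qed

end
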